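(* Let $p\in(1,\infty)$ and let $w\in A_p(\Omega)$ be a weight. Then for every $r\in(1,\infty)$ there is $C>0$ such that for every sequence $(f_j)_{j\in\mathbb N}$ of measurable functions, $$\Big\|\Big\{\sum_{j\in\mathbb N}[M(f_j)]^r\Big\}^{1/r}\Big\|_{L^p(\Omega,w\,d\mathbb P)}\le C\Big\|\Big(\sum_{j\in\mathbb N}|f_j|^r\Big)^{1/r}\Big\|_{L^p(\Omega,w\,d\mathbb P)}.$$
   Context: Let $(\Omega,\mathcal F,\mathbb P)$ be a probability space, $(\mathcal F_n)_{n\in\mathbb Z_+}$ a nondecreasing sequence of sub-$\sigma$-algebras of $\mathcal F$, $\mathbb E_n$ the conditional expectation w.r.t. $\mathcal F_n$, and $M(f):=\sup_{n\in\mathbb Z_+}|\mathbb E_n f|$ the Doob maximal operator. A weight is a strictly positive integrable function $w$ on $\Omega$; $\|f\|_{L^p(\Omega,w\,d\mathbb P)}:=(\int_\Omega|f|^pw\,d\mathbb P)^{1/p}$. For $p\in(1,\infty)$, $w\in A_p(\Omega)$ if there is $K>0$ with $\mathbb E_n(w)[\mathbb E_n(w^{-1/(p-1)})]^{p-1}\le K$ a.e. for all $n\in\mathbb Z_+$. *)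

theory Defs
  imports "HOL-Probability.Probability"
begin

text \<open>Real powers of extended nonnegative reals (used with positive exponents only):
  \<infinity> to a positive power is \<infinity>.\<close>
definition epowr :: "ennreal \<Rightarrow> real \<Rightarrow> ennreal" where
  "epowr x a = (if x = \<infinity> then \<infinity> else ennreal (enn2real x powr a))"

definition is_filtration :: "'a measure \<Rightarrow> (nat \<Rightarrow> 'a measure) \<Rightarrow> bool" where
  "is_filtration M F \<longleftrightarrow> (\<forall>n. subalgebra M (F n)) \<and> (\<forall>m n. m \<le> n \<longrightarrow> sets (F m) \<subseteq> sets (F n))"

definition doob_max :: "'a measure \<Rightarrow> (nat \<Rightarrow> 'a measure) \<Rightarrow> ('a \<Rightarrow> real) \<Rightarrow> 'a \<Rightarrow> ennreal" where
  "doob_max M F f x = (SUP n. ennreal \<bar>real_cond_exp M (F n) f x\<bar>)"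

definition is_weight :: "'a measure \<Rightarrow> ('a \<Rightarrow> real) \<Rightarrow> bool" where
  "is_weight M w \<longleftrightarrow> integrable M w \<and> (\<forall>x\<in>space M. w x > 0)"

definition A_p_weight :: "'a measure \<Rightarrow> (nat \<Rightarrow> 'a measure) \<Rightarrow> real \<Rightarrow> ('a \<Rightarrow> real) \<Rightarrow> bool" where
  "A_p_weight M F p w \<longleftrightarrow> is_weight M w \<and>
     (\<exists>K>0. \<forall>n. AE x in M.
        nn_cond_exp M (F n) (\<lambda>y. ennreal (w y)) x *
        epowr (nn_cond_exp M (F n) (\<lambda>y. ennreal (w y powr (-1 / (p - 1)))) x) (p - 1)
        \<le> ennreal K)"

definition wLp_norm :: "'a measure \<Rightarrow> real \<Rightarrow> ('a \<Rightarrow> real) \<Rightarrow> ('a \<Rightarrow> ennreal) \<Rightarrow> ennreal" where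
  "wLp_norm M p w g = epowr (\<integral>\<^sup>+ x. epowr (g x) p * ennreal (w x) \<partial>M) (1 / p)"

end

theory Submission
  imports Defs
begin

text \<open>For \<open>p = r\<close> the inequality is the scalar \<open>A\<^sub>r\<close> maximal inequality, summed over \<open>j\<close>. The general
  case follows by Rubio de Francia extrapolation, because the scalar constant depends on the weight only
  through its \<open>A\<^sub>r\<close> constant. Without regularity of the filtration \<open>A\<^sub>p\<close> does not imply
  \<open>A\<^sub>q\<close> for some \<open>q < p\<close>; so the scalar inequality is proved by Lerner's argument, a pointwise domination by
  two weighted Doob maximal functions, and the extrapolation only uses that inequality together with
  algebraic manipulations of weights.\<close>

section \<open>Real powers of extended nonnegative reals\<close>

text \<open>The weight fed into the scalar inequality is built from the functions being estimated,
  so one constant has to serve a whole class of weights. This dictates the quantifiers in the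
  extrapolation lemmas: \<open>K'\<close> is fixed before \<open>C\<close>, because \<open>C\<close>
  is the scalar constant of the class \<open>Ap r K'\<close>. The weights come from the easy half of
  factorization: if \<open>w\<close> is in \<open>A_p\<close>, \<open>p < r\<close> and
  \<open>E n u \<le> s * u\<close> for all \<open>n\<close>, then \<open>w * u powr (p - r)\<close>
  is in \<open>A_r\<close>. The case \<open>r < p\<close> is reduced to the same product by duality,
  since passing to conjugate exponents reverses their order. Computing in the extended nonnegative
  reals removes integrability questions for the functions. Finiteness still matters when a majorant
  is built, since its series must converge, and when a term is absorbed on the left. Integrability
  of \<open>w\<close> makes the absorbed term finite for truncated functions, and makes the error of
  the final perturbation by a constant vanish.\<close>

lemma epowr_top [simp]: "epowr top a = top"
  by (simp add: epowr_def)

lemma epowr_0 [simp]: "epowr 0 a = 0"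
  by (simp add: epowr_def)

lemma epowr_ennreal [simp]: "0 \<le> x \<Longrightarrow> epowr (ennreal x) a = ennreal (x powr a)"
  by (simp add: epowr_def)

lemma epowr_numeral [simp]: "epowr (numeral n) a = ennreal (numeral n powr a)"
  using epowr_ennreal[of "numeral n" a] by (simp del: epowr_ennreal)

lemma epowr_exponent_1 [simp]: "epowr x 1 = x"
  by (cases x rule: ennreal_cases) auto

lemma epowr_mono: "0 < a \<Longrightarrow> x \<le> y \<Longrightarrow> epowr x a \<le> epowr y a"
  by (cases x rule: ennreal_cases; cases y rule: ennreal_cases)
    (auto simp: powr_mono2 top_unique)

lemma epowr_mult: "0 < a \<Longrightarrow> epowr (x * y) a = epowr x a * epowr y a"
  by (cases x rule: ennreal_cases; cases y rule: ennreal_cases)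
    (auto simp: powr_mult ennreal_mult[symmetric] ennreal_mult_top ennreal_top_mult)

lemma epowr_epowr: "epowr (epowr x a) b = epowr x (a * b)"
  by (cases x rule: ennreal_cases) (auto simp: powr_powr)

lemma epowr_inverse_exponent [simp]:
  assumes "0 < a"
  shows "epowr (epowr x a) (1 / a) = x" "epowr (epowr x (1 / a)) a = x"
  using assms by (simp_all add: epowr_epowr)

lemma epowr_add: "epowr x (a + b) = epowr x a * epowr x b"
  by (cases x rule: ennreal_cases) (auto simp: powr_add ennreal_mult)

lemma epowr_eq_0_iff [simp]: "epowr x a = 0 \<longleftrightarrow> x = 0"
  by (cases x rule: ennreal_cases) auto

lemma epowr_eq_top_iff [simp]: "epowr x a = top \<longleftrightarrow> x = top"
  by (cases x rule: ennreal_cases) auto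

lemma borel_measurable_epowr [measurable (raw)]:
  "f \<in> borel_measurable N \<Longrightarrow> (\<lambda>x. epowr (f x) a) \<in> borel_measurable N"
  unfolding epowr_def by (intro measurable_If) auto

text \<open>A positive power is an order isomorphism of the extended half-line, with inverse
  exponent \<open>1 / a\<close>, hence preserves suprema.\<close>

lemma epowr_SUP:
  assumes "0 < a"
  shows "epowr (SUP n. f n) a = (SUP n. epowr (f n) a)"
proof (rule antisym)
  let ?S = "SUP n. epowr (f n) a"
  have "f n \<le> epowr ?S (1 / a)" for n
    using epowr_mono[of "1 / a" "epowr (f n) a" ?S] assms SUP_upper[of n UNIV "\<lambda>n. epowr (f n) a"] by simp
  then have "(SUP n. f n) \<le> epowr ?S (1 / a)"
    by (rule SUP_least)
  from epowr_mono[OF assms this] show "epowr (SUP n. f n) a \<le> ?S"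
    using assms by simp
qed (auto intro!: SUP_least epowr_mono assms SUP_upper)

lemma epowr_plus_le:
  assumes "0 < a"
  shows "epowr (x + y) a \<le> ennreal (2 powr a) * (epowr x a + epowr y a)"
proof -
  have "x + y \<le> ennreal 2 * max x y"
    by (auto simp: max_def mult_2 intro: add_mono)
  then have "epowr (x + y) a \<le> ennreal (2 powr a) * epowr (max x y) a"
    using epowr_mono[OF assms] epowr_mult[OF assms] by (metis epowr_ennreal zero_le_numeral)
  also have "epowr (max x y) a \<le> epowr x a + epowr y a"
    by (auto simp: max_def)
  finally show ?thesis
    by (simp add: mult_left_mono)
qed

text \<open>Bounding both factors by powers of \<open>max x y\<close> replaces the weighted AM-GM
  inequality; the loss in the constants is harmless.\<close>

lemma epowr_geometric_le_plus:
  assumes "0 < \<theta>" "\<theta> < 1"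
  shows "epowr x \<theta> * epowr y (1 - \<theta>) \<le> x + y"
proof -
  have "epowr x \<theta> * epowr y (1 - \<theta>) \<le> epowr (max x y) \<theta> * epowr (max x y) (1 - \<theta>)"
    using assms by (intro mult_mono epowr_mono) auto
  also have "\<dots> = max x y"
    by (simp flip: epowr_add)
  also have "\<dots> \<le> x + y"
    by (auto simp: max_def)
  finally show ?thesis .
qed

text \<open>Young's inequality with a free parameter \<open>d\<close>. If \<open>x\<close> is at
  most \<open>d\<close> times \<open>y\<close> to the power \<open>1 / (q - 1)\<close>, the first
  term alone dominates; otherwise \<open>y\<close> is at most \<open>x / d\<close> to the power
  \<open>q - 1\<close>, and the second term does.\<close>

lemma mult_le_epowr_plus_epowr:
  assumes q: "1 < q" and d: "0 < d"
  shows "x * y \<le> ennreal d * epowr y (q / (q - 1)) + ennreal (d powr (1 - q)) * epowr x q"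
proof (cases "x \<le> ennreal d * epowr y (1 / (q - 1))")
  case True
  have "q / (q - 1) = 1 / (q - 1) + 1"
    using q by (simp add: field_simps)
  then have "ennreal d * epowr y (1 / (q - 1)) * y = ennreal d * epowr y (q / (q - 1))"
    by (simp only: epowr_add epowr_exponent_1 mult.assoc)
  with mult_right_mono[OF True, of y] have "x * y \<le> ennreal d * epowr y (q / (q - 1))"
    by simp
  then show ?thesis
    by (rule order_trans) simp
next
  case False
  have "epowr y (1 / (q - 1)) = ennreal (1 / d) * (ennreal d * epowr y (1 / (q - 1)))"
    using d by (simp add: mult.assoc[symmetric] flip: ennreal_mult)
  also have "\<dots> \<le> ennreal (1 / d) * x"
    using False by (intro mult_left_mono) auto
  finally have "epowr (epowr y (1 / (q - 1))) (q - 1) \<le> epowr (ennreal (1 / d) * x) (q - 1)"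
    using q by (intro epowr_mono) auto
  then have "y \<le> ennreal (d powr (1 - q)) * epowr x (q - 1)"
    using q d by (simp add: epowr_mult powr_divide powr_diff)
  from mult_left_mono[OF this, of x] have "x * y \<le> ennreal (d powr (1 - q)) * epowr x (1 + (q - 1))"
    unfolding epowr_add by (simp add: ac_simps)
  then show ?thesis
    by (simp add: add_increasing)
qed

text \<open>Finiteness of \<open>x\<close> is essential: \<open>x = top\<close> satisfies the first
  premise for every \<open>y\<close>.\<close>

lemma ennreal_absorb_half:
  fixes x y :: ennreal
  assumes "x \<le> ennreal (1 / 2) * x + y" "x < top"
  shows "x \<le> 2 * y"
proof (cases y rule: ennreal_cases)
  case (real b)
  from assms(2) obtain a where a: "x = ennreal a" "0 \<le> a"
    by (cases x rule: ennreal_cases) auto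
  have "ennreal a \<le> ennreal (1 / 2 * a + b)"
    using assms(1) real a by (subst ennreal_plus, simp, simp, subst ennreal_mult) simp_all
  then have "a \<le> 2 * b"
    using real a by (subst (asm) ennreal_le_iff) auto
  then have "ennreal a \<le> ennreal (2 * b)"
    by (rule ennreal_leI)
  then show ?thesis
    using real a by (simp add: ennreal_mult)
qed (simp add: ennreal_mult_top)

section \<open>Layer cake representation of powers\<close>

lemma nn_integral_powr_from_0:
  assumes "0 < a" "0 \<le> c"
  shows "(\<integral>\<^sup>+ t. ennreal (a * t powr (a - 1)) * indicator {0<..<c} t \<partial>lborel) = ennreal (c powr a)"
proof -
  have "((\<lambda>t. a * t powr (a - 1)) has_integral (a * (c powr (a - 1 + 1) / (a - 1 + 1)))) {0..c}"
    by (rule has_integral_mult_right[OF has_integral_powr_from_0]) (use assms in auto)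
  then have "((\<lambda>t. a * t powr (a - 1)) has_integral (c powr a)) {0<..<c}"
    using assms by (simp add: has_integral_Icc_iff_Ioo)
  then show ?thesis
    using assms by (intro nn_integral_has_integral_lebesgue') auto
qed

lemma epowr_layer_cake_le:
  assumes "0 < a"
  shows "epowr X a \<le> (\<integral>\<^sup>+ t. ennreal (a * t powr (a - 1)) * indicator {t. 0 < t \<and> ennreal t < X} t \<partial>lborel)"
    (is "_ \<le> ?I X")
proof (cases X rule: ennreal_cases)
  case (real c)
  then have "{t. 0 < t \<and> ennreal t < X} = {0<..<c}"
    by (auto simp: ennreal_less_iff)
  then show ?thesis
    using real assms by (simp add: nn_integral_powr_from_0)
next
  case top
  \<comment> \<open>For infinite \<open>X\<close> the domain of integration is the whole positive
    half-line, which contains every \<open>{0<..<n}\<close>; so the integral exceeds all powers of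
    \<open>n\<close>.\<close>
  have "ennreal (real n powr a) \<le> ?I X" for n
    unfolding nn_integral_powr_from_0[OF assms of_nat_0_le_iff, of n, symmetric]
    using top by (intro nn_integral_mono) (auto simp: indicator_def)
  then have "ennreal (real n) \<le> epowr (?I X) (1 / a)" for n
    using epowr_mono[of "1 / a" "ennreal (real n powr a)" "?I X"] assms by (simp add: powr_powr)
  then have "(SUP n. of_nat n :: ennreal) \<le> epowr (?I X) (1 / a)"
    by (intro SUP_least) (simp add: ennreal_of_nat_eq_real_of_nat)
  then have "epowr (?I X) (1 / a) = top"
    by (simp add: ennreal_SUP_of_nat_eq_top top_unique)
  then show ?thesis
    using top by simp
qed

section \<open>Weighted Doob inequality\<close>

locale filtered_prob_space = prob_space M for M :: "'a measure" +
  fixes F :: "nat \<Rightarrow> 'a measure"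
  assumes filtration: "is_filtration M F"
begin

sublocale F: finite_measure_subalgebra M "F n" for n
  using filtration by unfold_locales (simp add: is_filtration_def)

abbreviation E :: "nat \<Rightarrow> ('a \<Rightarrow> ennreal) \<Rightarrow> 'a \<Rightarrow> ennreal" where
  "E n \<equiv> nn_cond_exp M (F n)"

definition nn_max :: "('a \<Rightarrow> ennreal) \<Rightarrow> 'a \<Rightarrow> ennreal" where
  "nn_max f x = (SUP n. E n f x)"

text \<open>By Bayes' formula the quotient is the conditional expectation of \<open>h\<close> for
  the measure with density \<open>u\<close>, so this is the Doob maximal operator of that measure.
  Writing it over \<open>M\<close> avoids conditioning with respect to a possibly infinite
  measure.\<close>

definition weighted_max :: "('a \<Rightarrow> ennreal) \<Rightarrow> ('a \<Rightarrow> ennreal) \<Rightarrow> 'a \<Rightarrow> ennreal" where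
  "weighted_max u h x = (SUP n. E n (\<lambda>y. h y * u y) x / E n u x)"

lemma borel_measurable_nn_max [measurable]: "nn_max f \<in> borel_measurable M"
  unfolding nn_max_def[abs_def] by measurable

lemma borel_measurable_weighted_max [measurable]: "weighted_max u h \<in> borel_measurable M"
  unfolding weighted_max_def[abs_def] by measurable

lemma space_F [simp]: "space (F n) = space M"
  using F.subalg[of n] by (simp add: subalgebra_def)

lemma sets_F_subset: "sets (F n) \<subseteq> sets M"
  using F.subalg[of n] by (simp add: subalgebra_def)

text \<open>The zero set of \<open>E n f\<close> belongs to \<open>F n\<close>, so \<open>f\<close>
  has integral 0 over it; as \<open>f\<close> is positive, the set is null.\<close>

lemma nn_cond_exp_pos:
  assumes [measurable]: "f \<in> borel_measurable M" and pos: "AE x in M. 0 < f x"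
  shows "AE x in M. 0 < E n f x"
proof -
  let ?Z = "{x \<in> space M. E n f x = 0}"
  have Z: "?Z \<in> sets (F n)"
    using measurable_sets[OF borel_measurable_nn_cond_exp, of "{0}" M "F n" f]
    by (simp add: vimage_def Int_def conj_commute)
  then have [measurable]: "?Z \<in> sets M"
    using sets_F_subset by auto
  have "(\<integral>\<^sup>+x. indicator ?Z x * f x \<partial>M) = (\<integral>\<^sup>+x. indicator ?Z x * E n f x \<partial>M)"
    using Z by (intro F.nn_cond_exp_intg[symmetric]) auto
  also have "\<dots> = (\<integral>\<^sup>+x. 0 \<partial>M)"
    by (intro nn_integral_cong) (auto simp: indicator_def)
  finally have "(\<integral>\<^sup>+x. indicator ?Z x * f x \<partial>M) = 0"
    by simp
  then have "AE x in M. indicator ?Z x * f x = 0"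
    by (subst (asm) nn_integral_0_iff_AE) auto
  with pos AE_space show ?thesis
    by eventually_elim (auto simp: indicator_def zero_less_iff_neq_zero split: if_splits)
qed

text \<open>Doob's stopping time argument, for two functions compared through a threshold
  \<open>l\<close>.\<close>

lemma maximal_weak_type:
  fixes l :: ennreal
  assumes [measurable]: "u \<in> borel_measurable M" "v \<in> borel_measurable M"
  defines "S \<equiv> {x \<in> space M. \<exists>n. l * E n u x < E n v x}"
  shows "l * (\<integral>\<^sup>+x\<in>S. u x \<partial>M) \<le> (\<integral>\<^sup>+x\<in>S. v x \<partial>M)"
proof -
  define A where "A n = {x \<in> space M. l * E n u x < E n v x}" for n
  have "{x \<in> space (F n). l * E n u x < E n v x} \<in> sets (F n)" for n
    by measurable
  then have A: "A n \<in> sets (F n)" for n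
    by (simp add: A_def)
  \<comment> \<open>\<open>D n\<close> is the event that the threshold is crossed for the first time
    at \<open>n\<close>. It lies in \<open>F n\<close>, so on it \<open>E n u\<close> and
    \<open>E n v\<close> integrate like \<open>u\<close> and \<open>v\<close>.\<close>
  define D where "D = disjointed A"
  have D: "D n \<in> sets (F n)" for n
  proof -
    have "A i \<in> sets (F n)" if "i < n" for i
      using A[of i] filtration that by (auto simp: is_filtration_def dest!: less_imp_le)
    then show ?thesis
      using A[of n] by (auto simp: D_def disjointed_def)
  qed
  then have DM [measurable]: "D n \<in> sets M" for n
    using sets_F_subset by blast
  have S: "S = (\<Union>n. D n)"
    by (auto simp: D_def UN_disjointed_eq A_def S_def)
  have "l * (\<integral>\<^sup>+x\<in>D n. u x \<partial>M) \<le> (\<integral>\<^sup>+x\<in>D n. v x \<partial>M)" for n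
  proof -
    have "l * (\<integral>\<^sup>+x\<in>D n. u x \<partial>M) = (\<integral>\<^sup>+x. (l * indicator (D n) x) * u x \<partial>M)"
      by (subst nn_integral_cmult[symmetric]) (auto simp: ac_simps)
    also have "\<dots> = (\<integral>\<^sup>+x. (l * indicator (D n) x) * E n u x \<partial>M)"
      using D by (intro F.nn_cond_exp_intg[symmetric]) auto
    also have "\<dots> \<le> (\<integral>\<^sup>+x. indicator (D n) x * E n v x \<partial>M)"
      using disjointed_subset[of A n]
      by (intro nn_integral_mono) (auto simp: indicator_def D_def A_def intro: less_imp_le)
    also have "\<dots> = (\<integral>\<^sup>+x. indicator (D n) x * v x \<partial>M)"
      using D by (intro F.nn_cond_exp_intg) auto
    finally show ?thesis
      by (simp add: mult.commute)
  qed
  then have "(\<Sum>n. l * (\<integral>\<^sup>+x\<in>D n. u x \<partial>M)) \<le> (\<Sum>n. \<integral>\<^sup>+x\<in>D n. v x \<partial>M)"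
    by (intro suminf_le) auto
  then show ?thesis
    unfolding S by (simp add: nn_integral_disjoint_family disjoint_family_disjointed D_def DM[unfolded D_def])
qed

text \<open>Values of \<open>h\<close> up to \<open>t / 2\<close> contribute at most
  \<open>t / 2\<close> to each quotient, so a quotient above \<open>t\<close> forces the remaining
  part \<open>v\<close> above \<open>t / 2\<close>. Restricting the right-hand side to large
  \<open>h\<close> keeps the later integral over \<open>t\<close> from diverging.\<close>

lemma weighted_max_weak_type:
  assumes [measurable]: "u \<in> borel_measurable M" "h \<in> borel_measurable M"
    and u: "\<And>n. AE x in M. 0 < E n u x \<and> E n u x < top"
    and t: "0 < t"
  shows "ennreal (t / 2) * (\<integral>\<^sup>+x\<in>{x \<in> space M. ennreal t < weighted_max u h x}. u x \<partial>M)
      \<le> (\<integral>\<^sup>+x\<in>{x. ennreal (t / 2) < h x}. h x * u x \<partial>M)"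
proof -
  define v where "v x = h x * u x * indicator {x. ennreal (t / 2) < h x} x" for x
  have [measurable]: "v \<in> borel_measurable M"
    unfolding v_def[abs_def] by measurable
  define S where "S = {x \<in> space M. \<exists>n. ennreal (t / 2) * E n u x < E n v x}"
  have [measurable]: "S \<in> sets M"
    unfolding S_def by measurable
  have le: "AE x in M. E n (\<lambda>y. h y * u y) x \<le> E n v x + ennreal (t / 2) * E n u x" for n
  proof -
    have "AE x in M. E n (\<lambda>y. h y * u y) x \<le> E n (\<lambda>y. v y + ennreal (t / 2) * u y) x"
      by (intro F.nn_cond_exp_mono AE_I2) (auto simp: v_def indicator_def not_less intro: mult_right_mono)
    moreover have "AE x in M. E n v x + E n (\<lambda>y. ennreal (t / 2) * u y) x = E n (\<lambda>y. v y + ennreal (t / 2) * u y) x"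
      by (intro F.nn_cond_exp_sum) auto
    moreover have "AE x in M. ennreal (t / 2) * E n u x = E n (\<lambda>y. ennreal (t / 2) * u y) x"
      by (intro F.nn_cond_exp_prod) auto
    ultimately show ?thesis
      by eventually_elim simp
  qed
  have "AE x in M. \<forall>n. E n (\<lambda>y. h y * u y) x \<le> E n v x + ennreal (t / 2) * E n u x \<and> 0 < E n u x \<and> E n u x < top"
    unfolding AE_all_countable using le u by (auto intro: AE_conjI)
  then have sub: "AE x in M. ennreal t < weighted_max u h x \<longrightarrow> x \<in> S"
    using AE_space
  proof eventually_elim
    case (elim x)
    show ?case
    proof
      assume "ennreal t < weighted_max u h x"
      then obtain n where n: "ennreal t < E n (\<lambda>y. h y * u y) x / E n u x"
        by (auto simp: weighted_max_def less_SUP_iff)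
      have "ennreal t * E n u x < E n (\<lambda>y. h y * u y) x"
      proof (rule ccontr)
        assume "\<not> ?thesis"
        then have "E n (\<lambda>y. h y * u y) x / E n u x \<le> ennreal t * E n u x / E n u x"
          by (intro divide_right_mono_ennreal) simp
        also have "ennreal t * E n u x / E n u x = ennreal t"
          using elim(1)[rule_format, of n] by (intro mult_divide_eq_ennreal) auto
        finally show False
          using n by simp
      qed
      also have "\<dots> \<le> E n v x + ennreal (t / 2) * E n u x"
        using elim by blast
      finally have less: "ennreal t * E n u x < E n v x + ennreal (t / 2) * E n u x" .
      have "ennreal (t / 2) * E n u x < E n v x"
      proof (rule ccontr)
        assume "\<not> ?thesis"
        then have "E n v x + ennreal (t / 2) * E n u x \<le> (ennreal (t / 2) + ennreal (t / 2)) * E n u x"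
          by (simp add: distrib_right add_right_mono)
        also have "ennreal (t / 2) + ennreal (t / 2) = ennreal t"
          using t by (simp flip: ennreal_plus)
        finally show False
          using less by simp
      qed
      then show "x \<in> S"
        using elim by (auto simp: S_def)
    qed
  qed
  have "ennreal (t / 2) * (\<integral>\<^sup>+x\<in>{x \<in> space M. ennreal t < weighted_max u h x}. u x \<partial>M)
      \<le> ennreal (t / 2) * (\<integral>\<^sup>+x\<in>S. u x \<partial>M)"
    using sub by (intro mult_left_mono nn_integral_mono_AE) (auto simp: indicator_def elim!: eventually_mono)
  also have "\<dots> \<le> (\<integral>\<^sup>+x\<in>S. v x \<partial>M)"
    unfolding S_def by (rule maximal_weak_type) auto
  also have "\<dots> \<le> (\<integral>\<^sup>+x. v x \<partial>M)"
    by (intro nn_integral_mono) (auto simp: indicator_def)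
  finally show ?thesis
    by (simp add: v_def)
qed

text \<open>The weak type bound is integrated against \<open>p * t powr (p - 1)\<close> as in
  Marcinkiewicz interpolation. The density \<open>u\<close> stays in the integrand, so Fubini is
  needed for \<open>M\<close> and \<open>lborel\<close> only.\<close>

lemma weighted_max_strong_type:
  assumes [measurable]: "u \<in> borel_measurable M" "h \<in> borel_measurable M"
    and u: "\<And>n. AE x in M. 0 < E n u x \<and> E n u x < top"
    and p: "1 < p"
  shows "(\<integral>\<^sup>+x. epowr (weighted_max u h x) p * u x \<partial>M)
    \<le> ennreal (2 powr p * p / (p - 1)) * (\<integral>\<^sup>+x. epowr (h x) p * u x \<partial>M)"
proof -
  interpret L: pair_sigma_finite M lborel ..
  let ?X = "weighted_max u h"
  define c where "c t = ennreal (p * t powr (p - 1))" for t :: real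
  \<comment> \<open>\<open>d t\<close> is \<open>c t\<close> divided by the factor
    \<open>t / 2\<close> of the weak type bound. Its integral over \<open>0 < t < 2 * h x\<close>,
    finite at 0 because \<open>p > 1\<close>, produces the constant.\<close>
  define d where "d t = ennreal (2 * p * t powr (p - 2))" for t :: real
  have [measurable]: "c \<in> borel_measurable borel" "d \<in> borel_measurable borel"
    unfolding c_def[abs_def] d_def[abs_def] by measurable
  have "(\<integral>\<^sup>+x. epowr (?X x) p * u x \<partial>M)
      \<le> (\<integral>\<^sup>+x. (\<integral>\<^sup>+t. c t * indicator {t. 0 < t \<and> ennreal t < ?X x} t \<partial>lborel) * u x \<partial>M)"
    using p unfolding c_def by (intro nn_integral_mono mult_right_mono epowr_layer_cake_le) auto
  also have "\<dots> = (\<integral>\<^sup>+x. (\<integral>\<^sup>+t. c t * indicator {t. 0 < t \<and> ennreal t < ?X x} t * u x \<partial>lborel) \<partial>M)"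
    by (intro nn_integral_cong nn_integral_multc[symmetric]) measurable
  also have "\<dots> = (\<integral>\<^sup>+t. (\<integral>\<^sup>+x. c t * indicator {t. 0 < t \<and> ennreal t < ?X x} t * u x \<partial>M) \<partial>lborel)"
    by (intro L.Fubini'[symmetric]) measurable
  also have "\<dots> \<le> (\<integral>\<^sup>+t. (\<integral>\<^sup>+x. d t * indicator {t. 0 < t \<and> ennreal (t / 2) < h x} t * (h x * u x) \<partial>M) \<partial>lborel)"
  proof (rule nn_integral_mono)
    fix t :: real
    show "(\<integral>\<^sup>+x. c t * indicator {t. 0 < t \<and> ennreal t < ?X x} t * u x \<partial>M)
       \<le> (\<integral>\<^sup>+x. d t * indicator {t. 0 < t \<and> ennreal (t / 2) < h x} t * (h x * u x) \<partial>M)"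
    proof (cases "0 < t")
      case True
      have cd: "c t = d t * ennreal (t / 2)"
        using True p powr_add[of t "p - 2" 1] by (simp add: c_def d_def flip: ennreal_mult)
      have "(\<integral>\<^sup>+x. c t * indicator {t. 0 < t \<and> ennreal t < ?X x} t * u x \<partial>M)
        = (\<integral>\<^sup>+x. c t * (u x * indicator {x \<in> space M. ennreal t < ?X x} x) \<partial>M)"
        using True by (intro nn_integral_cong) (auto simp: indicator_def)
      also have "\<dots> = d t * (ennreal (t / 2) * (\<integral>\<^sup>+x\<in>{x \<in> space M. ennreal t < ?X x}. u x \<partial>M))"
        by (subst nn_integral_cmult) (auto simp: cd mult.assoc)
      also have "\<dots> \<le> d t * (\<integral>\<^sup>+x\<in>{x. ennreal (t / 2) < h x}. h x * u x \<partial>M)"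
        using True u by (intro mult_left_mono weighted_max_weak_type) auto
      also have "\<dots> = (\<integral>\<^sup>+x. d t * indicator {t. 0 < t \<and> ennreal (t / 2) < h x} t * (h x * u x) \<partial>M)"
        using True by (subst nn_integral_cmult[symmetric])
          (auto intro!: nn_integral_cong simp: indicator_def)
      finally show ?thesis .
    next
      case False
      then have "(\<integral>\<^sup>+x. c t * indicator {t. 0 < t \<and> ennreal t < ?X x} t * u x \<partial>M) = (\<integral>\<^sup>+x. 0 \<partial>M)"
        by (intro nn_integral_cong) (auto simp: indicator_def)
      then show ?thesis
        by simp
    qed
  qed
  also have "\<dots> = (\<integral>\<^sup>+x. (\<integral>\<^sup>+t. d t * indicator {t. 0 < t \<and> ennreal (t / 2) < h x} t * (h x * u x) \<partial>lborel) \<partial>M)"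
    by (intro L.Fubini') measurable
  also have "\<dots> = (\<integral>\<^sup>+x. (\<integral>\<^sup>+t. d t * indicator {t. 0 < t \<and> ennreal (t / 2) < h x} t \<partial>lborel) * (h x * u x) \<partial>M)"
    by (intro nn_integral_cong nn_integral_multc) measurable
  also have "\<dots> \<le> (\<integral>\<^sup>+x. ennreal (2 powr p * p / (p - 1)) * (epowr (h x) p * u x) \<partial>M)"
  proof (intro nn_integral_mono)
    fix x
    show "(\<integral>\<^sup>+t. d t * indicator {t. 0 < t \<and> ennreal (t / 2) < h x} t \<partial>lborel) * (h x * u x)
       \<le> ennreal (2 powr p * p / (p - 1)) * (epowr (h x) p * u x)"
    proof (cases "h x" rule: ennreal_cases)
      case top
      then show ?thesis
        using p by (cases "u x = 0") (auto simp: ennreal_mult_eq_top_iff ennreal_top_mult)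
    next
      case (real y)
      have "d t * indicator {t. 0 < t \<and> ennreal (t / 2) < h x} t
        = ennreal (2 * p / (p - 1)) * (ennreal ((p - 1) * t powr (p - 1 - 1)) * indicator {0<..<2 * y} t)" for t
        using real p by (auto simp: d_def indicator_def ennreal_less_iff simp flip: ennreal_mult)
      then have "(\<integral>\<^sup>+t. d t * indicator {t. 0 < t \<and> ennreal (t / 2) < h x} t \<partial>lborel)
        = ennreal (2 * p / (p - 1)) * ennreal ((2 * y) powr (p - 1))"
        using real p nn_integral_powr_from_0[of "p - 1" "2 * y"] by (simp add: nn_integral_cmult)
      then have "(\<integral>\<^sup>+t. d t * indicator {t. 0 < t \<and> ennreal (t / 2) < h x} t \<partial>lborel) * (h x * u x)
        = ennreal (2 * p / (p - 1) * (2 * y) powr (p - 1) * y) * u x"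
        using real p by (subst ennreal_mult, simp, simp, subst ennreal_mult) (simp_all add: mult.assoc)
      also have "2 * p / (p - 1) * (2 * y) powr (p - 1) * y = 2 powr p * p / (p - 1) * y powr p"
        using real p powr_add[of y "p - 1" 1] powr_add[of 2 "p - 1" 1]
        by (simp add: powr_mult)
      also have "ennreal \<dots> * u x = ennreal (2 powr p * p / (p - 1)) * (epowr (h x) p * u x)"
        using real p by (subst ennreal_mult) (simp_all add: mult.assoc)
      finally show ?thesis
        by simp
    qed
  qed
  also have "\<dots> = ennreal (2 powr p * p / (p - 1)) * (\<integral>\<^sup>+x. epowr (h x) p * u x \<partial>M)"
    by (intro nn_integral_cmult) measurable
  finally show ?thesis .
qed

section \<open>Muckenhoupt weights\<close>

text \<open>In contrast to \<^const>\<open>A_p_weight\<close>, integrability of \<open>w\<close> is not required: the class is then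
  closed under passing to the dual weight, which need not be integrable.\<close>
definition Ap :: "real \<Rightarrow> real \<Rightarrow> ('a \<Rightarrow> real) \<Rightarrow> bool" where
  "Ap p K w \<longleftrightarrow> w \<in> borel_measurable M \<and> (\<forall>x\<in>space M. 0 < w x) \<and>
     (\<forall>n. AE x in M. E n (\<lambda>y. ennreal (w y)) x *
        epowr (E n (\<lambda>y. ennreal (w y powr (-1 / (p - 1)))) x) (p - 1) \<le> ennreal K)"

lemma Ap_measurable: "Ap p K w \<Longrightarrow> w \<in> borel_measurable M"
  and Ap_pos: "Ap p K w \<Longrightarrow> x \<in> space M \<Longrightarrow> 0 < w x"
  and Ap_bound: "Ap p K w \<Longrightarrow> AE x in M. E n (\<lambda>y. ennreal (w y)) x *
        epowr (E n (\<lambda>y. ennreal (w y powr (-1 / (p - 1)))) x) (p - 1) \<le> ennreal K"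
  by (auto simp: Ap_def)

text \<open>Both factors in the \<open>A_p\<close> condition are positive and their product is
  bounded, so neither can be infinite. This replaces integrability of \<open>w\<close> and of its
  dual weight.\<close>

lemma Ap_cond_exp:
  assumes "1 < p" and Ap: "Ap p K w"
  shows "AE x in M. 0 < E n (\<lambda>y. ennreal (w y)) x \<and> E n (\<lambda>y. ennreal (w y)) x < top \<and>
      0 < E n (\<lambda>y. ennreal (w y powr (-1 / (p - 1)))) x \<and>
      E n (\<lambda>y. ennreal (w y powr (-1 / (p - 1)))) x < top"
proof -
  note [measurable] = Ap_measurable[OF Ap]
  have "AE x in M. 0 < E n (\<lambda>y. ennreal (w y)) x"
    by (intro nn_cond_exp_pos) (auto intro!: AE_I2 simp: Ap_pos[OF Ap])
  moreover have "AE x in M. 0 < E n (\<lambda>y. ennreal (w y powr (-1 / (p - 1)))) x"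
    using Ap_pos[OF Ap] by (intro nn_cond_exp_pos) (fastforce intro!: AE_I2)+
  ultimately show ?thesis
    using Ap_bound[OF Ap, of n]
  proof eventually_elim
    case (elim x)
    then have "E n (\<lambda>y. ennreal (w y)) x *
        epowr (E n (\<lambda>y. ennreal (w y powr (-1 / (p - 1)))) x) (p - 1) < top"
      by (simp add: le_less_trans)
    with elim show ?case
      by (auto simp: ennreal_mult_less_top less_top[symmetric])
  qed
qed

text \<open>Dualizing twice returns \<open>w\<close>, so the new condition is the old one raised to
  the power \<open>1 / (p - 1)\<close>, which also explains the constant.\<close>

lemma Ap_dual:
  assumes p: "1 < p" and K: "0 < K" and Ap: "Ap p K w"
  shows "Ap (p / (p - 1)) (K powr (1 / (p - 1))) (\<lambda>x. w x powr (-1 / (p - 1)))"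
  unfolding Ap_def
proof (intro conjI allI ballI)
  note [measurable] = Ap_measurable[OF Ap]
  show "(\<lambda>x. w x powr (-1 / (p - 1))) \<in> borel_measurable M"
    by measurable
  show "0 < w x powr (-1 / (p - 1))" if "x \<in> space M" for x
    using Ap_pos[OF Ap that] by simp
  have p': "p / (p - 1) - 1 = 1 / (p - 1)"
    using p by (simp add: field_simps)
  have exps: "-1 / (p - 1) * (-1 / (1 / (p - 1))) = 1"
    using p by (simp add: field_simps)
  fix n
  have "AE x in M. E n (\<lambda>y. ennreal ((w y powr (-1 / (p - 1))) powr (-1 / (p / (p - 1) - 1)))) x
      = E n (\<lambda>y. ennreal (w y)) x"
    using Ap_pos[OF Ap] unfolding p' powr_powr exps
    by (intro F.nn_cond_exp_cong AE_I2) (auto simp: less_imp_le)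
  with Ap_bound[OF Ap, of n]
  show "AE x in M. E n (\<lambda>y. ennreal (w y powr (-1 / (p - 1)))) x *
     epowr (E n (\<lambda>y. ennreal ((w y powr (-1 / (p - 1))) powr (-1 / (p / (p - 1) - 1)))) x)
      (p / (p - 1) - 1) \<le> ennreal (K powr (1 / (p - 1)))"
  proof eventually_elim
    case (elim x)
    have "epowr (E n (\<lambda>y. ennreal (w y)) x *
        epowr (E n (\<lambda>y. ennreal (w y powr (-1 / (p - 1)))) x) (p - 1)) (1 / (p - 1))
        \<le> epowr (ennreal K) (1 / (p - 1))"
      using elim(1) p by (intro epowr_mono) auto
    then show ?case
      using K p unfolding p' elim(2)[unfolded p'] by (simp add: epowr_mult epowr_epowr mult.commute)
  qed
qed

text \<open>With \<open>\<sigma> = w powr (-1 / (p - 1))\<close>, the \<open>A\<^sub>p\<close> condition gives the pointwise bound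
  \<open>(M f) powr (p - 1) \<le> K * M\<^sub>w ((M\<^sub>\<sigma> (f / \<sigma>)) powr (p - 1) / w)\<close>, which reduces the claim to
  Doob's inequality for the measures with densities \<open>w\<close> and \<open>\<sigma>\<close>.\<close>
lemma Ap_strong_type:
  assumes p: "1 < p" and K: "0 < K"
  shows "\<exists>C>0. \<forall>w f. Ap p K w \<longrightarrow> f \<in> borel_measurable M \<longrightarrow>
    (\<integral>\<^sup>+x. epowr (nn_max f x) p * ennreal (w x) \<partial>M)
     \<le> ennreal C * (\<integral>\<^sup>+x. epowr (f x) p * ennreal (w x) \<partial>M)"
proof -
  define q where "q = p / (p - 1)"
  have q: "1 < q" "(p - 1) * q = p" "1 - q = -1 / (p - 1)"
    using p by (auto simp: q_def field_simps)
  define C1 where "C1 = 2 powr q * q / (q - 1)"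
  define C2 where "C2 = 2 powr p * p / (p - 1)"
  have C: "0 < C1" "0 < C2"
    using p q by (auto simp: C1_def C2_def)
  have "(\<integral>\<^sup>+x. epowr (nn_max f x) p * ennreal (w x) \<partial>M)
     \<le> ennreal (K powr q * C1 * C2) * (\<integral>\<^sup>+x. epowr (f x) p * ennreal (w x) \<partial>M)"
    if Ap: "Ap p K w" and [measurable]: "f \<in> borel_measurable M" for w f
  proof -
    note [measurable] = Ap_measurable[OF Ap]
    define \<sigma> where "\<sigma> x = w x powr (-1 / (p - 1))" for x
    \<comment> \<open>Here \<open>h = f / \<sigma>\<close>, so \<open>h * \<sigma>\<close> averages
      to \<open>E n f\<close>. In the same way \<open>H\<close> is a power of \<open>G\<close>
      divided by \<open>w\<close>.\<close>
    define h where "h x = f x * ennreal (w x powr (1 / (p - 1)))" for x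
    define G where "G = weighted_max (\<lambda>x. ennreal (\<sigma> x)) h"
    define H where "H x = epowr (G x) (p - 1) * ennreal (1 / w x)" for x
    let ?w = "\<lambda>x. ennreal (w x)" and ?\<sigma> = "\<lambda>x. ennreal (\<sigma> x)"
    have [measurable]: "\<sigma> \<in> borel_measurable M" "h \<in> borel_measurable M" "G \<in> borel_measurable M"
      "H \<in> borel_measurable M"
      unfolding \<sigma>_def[abs_def] h_def[abs_def] G_def H_def[abs_def] by measurable
    have inv: "ennreal (1 / w x) * ennreal (w x) = 1" if "x \<in> space M" for x
      using Ap_pos[OF Ap that] by (simp flip: ennreal_mult)
    have fin: "AE x in M. 0 < E n ?w x \<and> E n ?w x < top \<and> 0 < E n ?\<sigma> x \<and> E n ?\<sigma> x < top" for n
      unfolding \<sigma>_def by (rule Ap_cond_exp[OF p Ap])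
    have "AE x in M. epowr (E n f x) (p - 1) \<le> ennreal K * weighted_max ?w H x" for n
    proof -
      define Q where "Q x = E n f x / E n ?\<sigma> x" for x
      have [measurable]: "Q \<in> borel_measurable (F n)"
        unfolding Q_def[abs_def] by measurable
      have [measurable]: "Q \<in> borel_measurable M"
        unfolding Q_def[abs_def] by measurable
      have "AE x in M. E n (\<lambda>y. h y * ?\<sigma> y) x = E n f x"
        using Ap_pos[OF Ap] Ap_pos[OF Ap, THEN less_imp_neq] by (intro F.nn_cond_exp_cong AE_I2)
          (auto simp: h_def \<sigma>_def mult.assoc powr_add[symmetric] simp flip: ennreal_mult)
      then have QG: "AE x in M. Q x \<le> G x"
        by eventually_elim (auto simp: Q_def G_def weighted_max_def intro: SUP_upper2[of n])
      \<comment> \<open>\<open>Q\<close> is \<open>F n\<close>-measurable, hence unchanged by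
        averaging, and lies below \<open>G\<close>. So its power is at most the average of the power
        of \<open>G\<close>, that is, of \<open>H * w\<close>.\<close>
      have "AE x in M. epowr (Q x) (p - 1) = E n (\<lambda>x. epowr (Q x) (p - 1)) x"
        by (intro F.nn_cond_exp_F_meas) measurable
      moreover have "AE x in M. E n (\<lambda>x. epowr (Q x) (p - 1)) x \<le> E n (\<lambda>x. epowr (G x) (p - 1)) x"
        using QG p by (intro F.nn_cond_exp_mono) (auto elim!: eventually_mono intro!: epowr_mono)
      moreover have "AE x in M. E n (\<lambda>x. epowr (G x) (p - 1)) x = E n (\<lambda>x. H x * ?w x) x"
        by (intro F.nn_cond_exp_cong AE_I2) (auto simp: H_def mult.assoc inv)
      ultimately show ?thesis
        using fin[of n] Ap_bound[OF Ap, of n, folded \<sigma>_def]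
      proof eventually_elim
        case (elim x)
        then have w0: "E n ?w x \<noteq> 0" "E n ?w x \<noteq> top" and s0: "E n ?\<sigma> x \<noteq> 0" "E n ?\<sigma> x \<noteq> top"
          by auto
        have "E n f x = Q x * E n ?\<sigma> x"
          using s0 by (simp add: Q_def ennreal_divide_times ennreal_divide_self less_top)
        then have "epowr (E n f x) (p - 1) = epowr (Q x) (p - 1) * epowr (E n ?\<sigma> x) (p - 1)"
          using p by (simp add: epowr_mult)
        \<comment> \<open>The \<open>A_p\<close> condition trades the power of
          \<open>E n \<sigma>\<close> for \<open>K / E n w\<close>, which supplies the denominator
          of the weighted average of \<open>H\<close>.\<close>
        also have "\<dots> \<le> E n (\<lambda>x. H x * ?w x) x * (ennreal K / E n ?w x)"
        proof (intro mult_mono)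
          have "epowr (E n ?\<sigma> x) (p - 1) = E n ?w x * epowr (E n ?\<sigma> x) (p - 1) / E n ?w x"
            using w0 by (subst mult.commute) (simp add: mult_divide_eq_ennreal)
          also have "\<dots> \<le> ennreal K / E n ?w x"
            using elim by (intro divide_right_mono_ennreal) auto
          finally show "epowr (E n ?\<sigma> x) (p - 1) \<le> ennreal K / E n ?w x" .
        qed (use elim in auto)
        also have "\<dots> = ennreal K * (E n (\<lambda>x. H x * ?w x) x / E n ?w x)"
          by (simp add: ennreal_times_divide mult.commute)
        also have "\<dots> \<le> ennreal K * weighted_max ?w H x"
          unfolding weighted_max_def by (intro mult_left_mono SUP_upper) auto
        finally show ?case .
      qed
    qed
    then have "AE x in M. \<forall>n. epowr (E n f x) (p - 1) \<le> ennreal K * weighted_max ?w H x"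
      by (simp add: AE_all_countable)
    then have "AE x in M. epowr (nn_max f x) p \<le> ennreal (K powr q) * epowr (weighted_max ?w H x) q"
    proof eventually_elim
      case (elim x)
      then have "epowr (nn_max f x) (p - 1) \<le> ennreal K * weighted_max ?w H x"
        using p by (auto simp: nn_max_def epowr_SUP intro: SUP_least)
      then have "epowr (epowr (nn_max f x) (p - 1)) q \<le> epowr (ennreal K * weighted_max ?w H x) q"
        using q by (intro epowr_mono) auto
      then show ?case
        using q K by (simp add: epowr_epowr epowr_mult)
    qed
    then have "(\<integral>\<^sup>+x. epowr (nn_max f x) p * ?w x \<partial>M)
        \<le> (\<integral>\<^sup>+x. ennreal (K powr q) * (epowr (weighted_max ?w H x) q * ?w x) \<partial>M)"
      by (intro nn_integral_mono_AE) (auto elim!: eventually_mono intro: mult_right_mono simp flip: mult.assoc)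
    also have "\<dots> = ennreal (K powr q) * (\<integral>\<^sup>+x. epowr (weighted_max ?w H x) q * ?w x \<partial>M)"
      by (intro nn_integral_cmult) measurable
    also have "(\<integral>\<^sup>+x. epowr (weighted_max ?w H x) q * ?w x \<partial>M) \<le> ennreal C1 * (\<integral>\<^sup>+x. epowr (H x) q * ?w x \<partial>M)"
      unfolding C1_def using q
      by (intro weighted_max_strong_type) (auto intro: eventually_mono[OF fin])
    \<comment> \<open>Since \<open>(p - 1) * q = p\<close> and
      \<open>w powr (1 - q) = \<sigma>\<close>, the first Doob inequality, exponent \<open>q\<close>
      and density \<open>w\<close>, leaves exactly the left side of a second one, exponent
      \<open>p\<close> and density \<open>\<sigma>\<close>.\<close>
    also have "(\<integral>\<^sup>+x. epowr (H x) q * ?w x \<partial>M) = (\<integral>\<^sup>+x. epowr (G x) p * ?\<sigma> x \<partial>M)"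
    proof (intro nn_integral_cong)
      fix x assume x: "x \<in> space M"
      note wx = Ap_pos[OF Ap x]
      have "(1 / w x) powr q * w x = \<sigma> x"
        using wx powr_add[of "w x" "- q" 1] q(3) by (simp add: powr_divide powr_minus_divide \<sigma>_def)
      then show "epowr (H x) q * ?w x = epowr (G x) p * ?\<sigma> x"
        using wx q by (simp add: H_def epowr_mult epowr_epowr mult.assoc flip: ennreal_mult)
    qed
    also have "\<dots> \<le> ennreal C2 * (\<integral>\<^sup>+x. epowr (h x) p * ?\<sigma> x \<partial>M)"
      unfolding C2_def G_def using p
      by (intro weighted_max_strong_type) (auto intro: eventually_mono[OF fin])
    also have "(\<integral>\<^sup>+x. epowr (h x) p * ?\<sigma> x \<partial>M) = (\<integral>\<^sup>+x. epowr (f x) p * ?w x \<partial>M)"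
    proof (intro nn_integral_cong)
      fix x assume x: "x \<in> space M"
      note wx = Ap_pos[OF Ap x]
      have "p / (p - 1) + (-1 / (p - 1)) = 1"
        using p by (simp flip: diff_divide_distrib)
      then have "(w x powr (1 / (p - 1))) powr p * \<sigma> x = w x"
        using wx p by (simp add: \<sigma>_def powr_powr flip: powr_add)
      then show "epowr (h x) p * ?\<sigma> x = epowr (f x) p * ?w x"
        using p by (simp add: h_def epowr_mult mult.assoc \<sigma>_def flip: ennreal_mult)
    qed
    finally show ?thesis
      using C by (simp add: ennreal_mult mult.assoc mult_left_mono)
  qed
  moreover have "0 < K powr q * C1 * C2"
    using C K by simp
  ultimately show ?thesis
    by blast
qed

section \<open>Conditional expectations of series and geometric means, and products of
  weights\<close>

lemma nn_cond_exp_suminf: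
  assumes [measurable]: "\<And>k. f k \<in> borel_measurable M"
  shows "AE x in M. (\<Sum>k. E n (f k) x) = E n (\<lambda>x. \<Sum>k. f k x) x"
proof (rule F.nn_cond_exp_charact)
  fix A assume A: "A \<in> sets (F n)"
  then have [measurable]: "A \<in> sets M"
    using sets_F_subset by blast
  have "(\<integral>\<^sup>+x\<in>A. (\<Sum>k. f k x) \<partial>M) = (\<Sum>k. \<integral>\<^sup>+x. indicator A x * f k x \<partial>M)"
    by (subst nn_integral_suminf[symmetric]) (auto simp: mult.commute intro!: nn_integral_cong)
  also have "\<dots> = (\<Sum>k. \<integral>\<^sup>+x. indicator A x * E n (f k) x \<partial>M)"
    using A by (subst F.nn_cond_exp_intg) auto
  also have "\<dots> = (\<integral>\<^sup>+x\<in>A. (\<Sum>k. E n (f k) x) \<partial>M)"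
    by (subst nn_integral_suminf[symmetric]) (auto simp: mult.commute intro!: nn_integral_cong)
  finally show "(\<integral>\<^sup>+x\<in>A. (\<Sum>k. f k x) \<partial>M) = (\<integral>\<^sup>+x\<in>A. (\<Sum>k. E n (f k) x) \<partial>M)" .
qed measurable

text \<open>Conditional Hoelder inequality up to a factor 2. Divide \<open>a\<close> and
  \<open>b\<close> by their conditional expectations, bound the geometric mean by the sum, and
  multiply by the \<open>F n\<close>-measurable \<open>c\<close>; both normalized summands average
  to 1.\<close>

lemma nn_cond_exp_geometric_le:
  assumes [measurable]: "a \<in> borel_measurable M" "b \<in> borel_measurable M"
    and a: "AE x in M. 0 < E n a x \<and> E n a x < top"
    and b: "AE x in M. 0 < E n b x \<and> E n b x < top"
    and \<theta>: "0 < \<theta>" "\<theta> < 1"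
  shows "AE x in M. E n (\<lambda>x. epowr (a x) \<theta> * epowr (b x) (1 - \<theta>)) x
    \<le> 2 * (epowr (E n a x) \<theta> * epowr (E n b x) (1 - \<theta>))"
proof -
  define c where "c x = epowr (E n a x) \<theta> * epowr (E n b x) (1 - \<theta>)" for x
  have [measurable]: "c \<in> borel_measurable (F n)" "c \<in> borel_measurable M"
    unfolding c_def[abs_def] by measurable
  have "AE x in M. epowr (a x) \<theta> * epowr (b x) (1 - \<theta>) \<le> c x / E n a x * a x + c x / E n b x * b x"
    using a b
  proof eventually_elim
    case (elim x)
    have eq: "a x = E n a x * (a x / E n a x)" "b x = E n b x * (b x / E n b x)"
      using elim by (auto simp: ennreal_times_divide mult.commute[of _ "a x"] mult.commute[of _ "b x"]
        mult_divide_eq_ennreal)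
    have "epowr (a x) \<theta> * epowr (b x) (1 - \<theta>)
      = c x * (epowr (a x / E n a x) \<theta> * epowr (b x / E n b x) (1 - \<theta>))"
      using \<theta> by (subst eq(1), subst eq(2), subst (1 2) epowr_mult) (auto simp: c_def ac_simps)
    also have "\<dots> \<le> c x * (a x / E n a x + b x / E n b x)"
      using \<theta> by (intro mult_left_mono epowr_geometric_le_plus) auto
    finally show ?case
      by (simp add: distrib_left ennreal_times_divide ennreal_divide_times)
  qed
  then have "AE x in M. E n (\<lambda>x. epowr (a x) \<theta> * epowr (b x) (1 - \<theta>)) x
      \<le> E n (\<lambda>x. c x / E n a x * a x + c x / E n b x * b x) x"
    by (intro F.nn_cond_exp_mono) auto
  moreover have "AE x in M. E n (\<lambda>x. c x / E n a x * a x) x + E n (\<lambda>x. c x / E n b x * b x) x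
      = E n (\<lambda>x. c x / E n a x * a x + c x / E n b x * b x) x"
    by (intro F.nn_cond_exp_sum) measurable
  moreover have "AE x in M. c x / E n a x * E n a x = E n (\<lambda>x. c x / E n a x * a x) x"
    by (intro F.nn_cond_exp_prod) measurable
  moreover have "AE x in M. c x / E n b x * E n b x = E n (\<lambda>x. c x / E n b x * b x) x"
    by (intro F.nn_cond_exp_prod) measurable
  ultimately show ?thesis
    using a b
  proof eventually_elim
    case (elim x)
    have "c x / E n a x * E n a x = c x" "c x / E n b x * E n b x = c x"
      using elim by (auto simp: ennreal_divide_times)
    with elim show ?case
      by (simp add: c_def mult_2)
  qed
qed

text \<open>The dual weight of the product is the geometric mean of that of \<open>w\<close> and of
  \<open>u\<close>, with \<open>\<theta> = (p - 1) / (r - 1)\<close>; its average costs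
  \<open>2 powr (r - 1)\<close>. The resulting factor \<open>E n u\<close> to the power
  \<open>r - p\<close> is cancelled by \<open>u powr (p - r)\<close> through the \<open>A_1\<close>
  condition, at the cost \<open>s powr (r - p)\<close>.\<close>

lemma Ap_times_A1_powr:
  assumes p: "1 < p" "p < r" and s: "0 < s" and K: "0 < K" and Ap: "Ap p K w"
    and u_meas [measurable]: "u \<in> borel_measurable M" and u_pos: "\<And>x. x \<in> space M \<Longrightarrow> 0 < u x"
    and A1: "\<And>n. AE x in M. E n (\<lambda>y. ennreal (u y)) x \<le> ennreal (s * u x)"
  shows "Ap r (2 powr (r - 1) * s powr (r - p) * K) (\<lambda>x. w x * u x powr (p - r))"
  unfolding Ap_def
proof (intro conjI allI ballI)
  note [measurable] = Ap_measurable[OF Ap]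
  show "(\<lambda>x. w x * u x powr (p - r)) \<in> borel_measurable M"
    by measurable
  show "0 < w x * u x powr (p - r)" if "x \<in> space M" for x
    using Ap_pos[OF Ap that] u_pos[OF that] by simp
  fix n
  define \<theta> where "\<theta> = (p - 1) / (r - 1)"
  have \<theta>: "0 < \<theta>" "\<theta> < 1" "\<theta> * (r - 1) = p - 1" "(1 - \<theta>) * (r - 1) = r - p"
    "-1 / (p - 1) * \<theta> = -1 / (r - 1)" "(p - r) * (-1 / (r - 1)) = 1 - \<theta>"
    using p by (simp_all add: \<theta>_def field_simps)
  let ?w = "\<lambda>x. ennreal (w x)" and ?\<sigma> = "\<lambda>x. ennreal (w x powr (-1 / (p - 1)))"
  let ?u = "\<lambda>x. ennreal (u x)" and ?W = "\<lambda>x. ennreal (w x * u x powr (p - r))"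
  let ?\<sigma>' = "\<lambda>x. ennreal ((w x * u x powr (p - r)) powr (-1 / (r - 1)))"
  have "AE x in M. 0 < E n ?u x"
    by (intro nn_cond_exp_pos) (auto intro!: AE_I2 simp: u_pos)
  with A1[of n] have u_fin: "AE x in M. 0 < E n ?u x \<and> E n ?u x < top"
    by eventually_elim (auto intro: le_less_trans)
  have \<sigma>_fin: "AE x in M. 0 < E n ?\<sigma> x \<and> E n ?\<sigma> x < top"
    using Ap_cond_exp[OF p(1) Ap, of n] by eventually_elim auto
  have "AE x in M. E n ?\<sigma>' x = E n (\<lambda>x. epowr (?\<sigma> x) \<theta> * epowr (?u x) (1 - \<theta>)) x"
  proof (intro F.nn_cond_exp_cong AE_I2)
    fix x assume x: "x \<in> space M"
    have "(w x * u x powr (p - r)) powr (-1 / (r - 1))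
      = (w x powr (-1 / (p - 1))) powr \<theta> * u x powr (1 - \<theta>)"
      using Ap_pos[OF Ap x] u_pos[OF x] unfolding powr_powr \<theta>(5) \<theta>(6)[symmetric]
      by (subst powr_mult) (simp_all add: powr_powr)
    then show "?\<sigma>' x = epowr (?\<sigma> x) \<theta> * epowr (?u x) (1 - \<theta>)"
      using u_pos[OF x] by (simp add: ennreal_mult)
  qed measurable
  moreover have "AE x in M. E n (\<lambda>x. epowr (?\<sigma> x) \<theta> * epowr (?u x) (1 - \<theta>)) x
      \<le> 2 * (epowr (E n ?\<sigma> x) \<theta> * epowr (E n ?u x) (1 - \<theta>))"
    using \<sigma>_fin u_fin \<theta> by (intro nn_cond_exp_geometric_le) auto
  \<comment> \<open>Moving the \<open>F n\<close>-measurable power inside the conditional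
    expectation lets the \<open>A_1\<close> condition act pointwise, next to
    \<open>u powr (p - r)\<close>.\<close>
  moreover have "AE x in M. epowr (E n ?u x) (r - p) * E n ?W x = E n (\<lambda>x. epowr (E n ?u x) (r - p) * ?W x) x"
    by (intro F.nn_cond_exp_prod) measurable
  moreover have "AE x in M. E n (\<lambda>x. epowr (E n ?u x) (r - p) * ?W x) x
      \<le> E n (\<lambda>x. ennreal (s powr (r - p)) * ?w x) x"
  proof (intro F.nn_cond_exp_mono)
    show "AE x in M. epowr (E n ?u x) (r - p) * ?W x \<le> ennreal (s powr (r - p)) * ?w x"
      using A1[of n] AE_space
    proof eventually_elim
      case (elim x)
      note wu = Ap_pos[OF Ap elim(2)] u_pos[OF elim(2)]
      have "epowr (E n ?u x) (r - p) * ?W x \<le> epowr (ennreal (s * u x)) (r - p) * ?W x"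
        using p elim by (intro mult_right_mono epowr_mono) auto
      also have "\<dots> = ennreal ((s * u x) powr (r - p) * (w x * u x powr (p - r)))"
        using s wu by (subst epowr_ennreal) (simp_all flip: ennreal_mult)
      also have "(s * u x) powr (r - p) * (w x * u x powr (p - r)) = s powr (r - p) * w x"
        using s wu powr_add[of "u x" "r - p" "p - r"] by (simp add: powr_mult)
      finally show ?case
        using wu by (simp add: ennreal_mult)
    qed
  qed measurable
  moreover have "AE x in M. ennreal (s powr (r - p)) * E n ?w x = E n (\<lambda>x. ennreal (s powr (r - p)) * ?w x) x"
    by (intro F.nn_cond_exp_prod) measurable
  ultimately show "AE x in M. E n ?W x * epowr (E n ?\<sigma>' x) (r - 1)
      \<le> ennreal (2 powr (r - 1) * s powr (r - p) * K)"
    using Ap_bound[OF Ap, of n]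
  proof eventually_elim
    case (elim x)
    have "E n ?W x * epowr (E n ?\<sigma>' x) (r - 1)
      \<le> E n ?W x * epowr (ennreal 2 * (epowr (E n ?\<sigma> x) \<theta> * epowr (E n ?u x) (1 - \<theta>))) (r - 1)"
      using elim p by (intro mult_left_mono epowr_mono) auto
    also have "\<dots> = ennreal (2 powr (r - 1)) * epowr (E n ?\<sigma> x) (p - 1) * (epowr (E n ?u x) (r - p) * E n ?W x)"
      using p by (subst epowr_mult, simp, subst epowr_mult, simp, subst epowr_ennreal)
        (simp_all add: epowr_epowr \<theta> ac_simps)
    also have "\<dots> \<le> ennreal (2 powr (r - 1)) * epowr (E n ?\<sigma> x) (p - 1) * (ennreal (s powr (r - p)) * E n ?w x)"
      using elim by (intro mult_left_mono) auto
    also have "\<dots> = ennreal (2 powr (r - 1)) * ennreal (s powr (r - p)) * (E n ?w x * epowr (E n ?\<sigma> x) (p - 1))"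
      by (simp add: ac_simps)
    also have "\<dots> \<le> ennreal (2 powr (r - 1)) * ennreal (s powr (r - p)) * ennreal K"
      using elim by (intro mult_left_mono) auto
    finally show ?case
      using K by (simp add: ennreal_mult)
  qed
qed

section \<open>Extrapolation\<close>

text \<open>The Rubio de Francia algorithm: \<open>u\<close> is a geometric series of rescaled iterates \<open>c k\<close> of the
  maximal operator, whose \<open>p\<close>-th moments are halved at each step.\<close>
lemma A1_majorant:
  assumes p: "1 < p" and K: "0 < K"
  shows "\<exists>s>0. \<exists>C>0. \<forall>w g. Ap p K w \<longrightarrow> g \<in> borel_measurable M \<longrightarrow> (\<forall>x\<in>space M. 0 < g x) \<longrightarrow>
    (\<integral>\<^sup>+x. epowr (g x) p * ennreal (w x) \<partial>M) < top \<longrightarrow>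
    (\<exists>u. u \<in> borel_measurable M \<and> (\<forall>x\<in>space M. 0 < u x) \<and> (AE x in M. g x \<le> ennreal (u x)) \<and>
      (\<forall>n. AE x in M. E n (\<lambda>y. ennreal (u y)) x \<le> ennreal (s * u x)) \<and>
      (\<integral>\<^sup>+x. ennreal (u x powr p) * ennreal (w x) \<partial>M)
        \<le> ennreal C * (\<integral>\<^sup>+x. epowr (g x) p * ennreal (w x) \<partial>M))"
proof -
  from Ap_strong_type[OF p K] obtain D where D: "0 < D" and
    strong: "\<And>w f. Ap p K w \<Longrightarrow> f \<in> borel_measurable M \<Longrightarrow>
      (\<integral>\<^sup>+x. epowr (nn_max f x) p * ennreal (w x) \<partial>M)
      \<le> ennreal D * (\<integral>\<^sup>+x. epowr (f x) p * ennreal (w x) \<partial>M)"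
    by blast
  \<comment> \<open>With this \<open>s\<close>, one application of \<open>nn_max\<close> divided by
    \<open>s\<close> at least halves the \<open>p\<close>-th moment.\<close>
  define s where "s = (2 * D) powr (1 / p)"
  have s: "0 < s"
    using D by (simp add: s_def)
  have sp: "(1 / s) powr p * D = 1 / 2"
    using D p by (simp add: s_def powr_divide powr_powr)
  have "\<exists>u. u \<in> borel_measurable M \<and> (\<forall>x\<in>space M. 0 < u x) \<and> (AE x in M. g x \<le> ennreal (u x)) \<and>
      (\<forall>n. AE x in M. E n (\<lambda>y. ennreal (u y)) x \<le> ennreal (2 * s * u x)) \<and>
      (\<integral>\<^sup>+x. ennreal (u x powr p) * ennreal (w x) \<partial>M)
        \<le> ennreal (2 powr p * 2) * (\<integral>\<^sup>+x. epowr (g x) p * ennreal (w x) \<partial>M)"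
    if Ap: "Ap p K w" and g_meas [measurable]: "g \<in> borel_measurable M" and g_pos: "\<forall>x\<in>space M. 0 < g x"
      and g_fin: "(\<integral>\<^sup>+x. epowr (g x) p * ennreal (w x) \<partial>M) < top" for w g
  proof -
    note [measurable] = Ap_measurable[OF Ap]
    let ?\<Phi> = "\<lambda>h. \<integral>\<^sup>+x. epowr (h x) p * ennreal (w x) \<partial>M"
    define c where "c k = ((\<lambda>h x. ennreal (1 / s) * nn_max h x) ^^ k) g" for k
    have c_0: "c 0 = g" and c_Suc: "c (Suc k) x = ennreal (1 / s) * nn_max (c k) x" for k x
      by (simp_all add: c_def)
    have [measurable]: "c k \<in> borel_measurable M" for k
      by (cases k) (auto simp: c_0 c_Suc[abs_def])
    have c_moment: "?\<Phi> (c k) \<le> ennreal ((1 / 2) ^ k) * ?\<Phi> g" for k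
    proof (induction k)
      case 0
      then show ?case
        by (simp add: c_0)
    next
      case (Suc k)
      have "?\<Phi> (c (Suc k)) = ennreal ((1 / s) powr p) * ?\<Phi> (nn_max (c k))"
        using p s by (subst nn_integral_cmult[symmetric]) (auto simp: c_Suc epowr_mult mult.assoc)
      also have "\<dots> \<le> ennreal ((1 / s) powr p) * (ennreal D * (ennreal ((1 / 2) ^ k) * ?\<Phi> g))"
        by (intro mult_left_mono order_trans[OF strong[OF Ap]] Suc) auto
      also have "\<dots> = ennreal ((1 / s) powr p * D * (1 / 2) ^ k) * ?\<Phi> g"
        using D by (simp add: ennreal_mult mult.assoc)
      finally show ?case
        by (simp add: sp)
    qed
    define U where "U x = (\<Sum>k. ennreal ((1 / 2) ^ k) * c k x)" for x
    have [measurable]: "U \<in> borel_measurable M"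
      unfolding U_def[abs_def] by measurable
    have geo: "(\<Sum>k. ennreal ((1 / 2) ^ k)) = 2"
      using geometric_sums[of "1 / 2 :: real"] by (subst suminf_ennreal_eq[where x=2]) auto
    have gU: "g x \<le> U x" for x
      using sum_le_suminf[of "\<lambda>k. ennreal ((1 / 2) ^ k) * c k x" "{0}"] by (simp add: U_def c_0)
    \<comment> \<open>The geometric weights bound \<open>U\<close> by twice the supremum of the
      \<open>c k\<close>, whose \<open>p\<close>-th power is at most the sum of the powers. This
      replaces Minkowski's inequality.\<close>
    have U_le: "epowr (U x) p \<le> ennreal (2 powr p) * (\<Sum>k. epowr (c k x) p)" for x
    proof -
      have "U x \<le> (\<Sum>k. ennreal ((1 / 2) ^ k) * (SUP k. c k x))"
        unfolding U_def by (intro suminf_le mult_left_mono SUP_upper) auto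
      also have "\<dots> = ennreal 2 * (SUP k. c k x)"
        by (simp only: ennreal_suminf_multc geo) simp
      finally have "epowr (U x) p \<le> epowr (ennreal 2 * (SUP k. c k x)) p"
        using p by (intro epowr_mono) auto
      also have "\<dots> = ennreal (2 powr p) * (SUP k. epowr (c k x) p)"
        using p by (subst epowr_mult) (auto simp: epowr_SUP)
      also have "(SUP k. epowr (c k x) p) \<le> (\<Sum>k. epowr (c k x) p)"
      proof (rule SUP_least)
        show "epowr (c k x) p \<le> (\<Sum>k. epowr (c k x) p)" for k
          using sum_le_suminf[of "\<lambda>k. epowr (c k x) p" "{k}"] by simp
      qed
      finally show ?thesis
        by (simp add: mult_left_mono)
    qed
    have "?\<Phi> U \<le> (\<integral>\<^sup>+x. ennreal (2 powr p) * (\<Sum>k. epowr (c k x) p * ennreal (w x)) \<partial>M)"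
    proof (rule nn_integral_mono)
      fix x
      have "epowr (U x) p * ennreal (w x) \<le> ennreal (2 powr p) * (\<Sum>k. epowr (c k x) p) * ennreal (w x)"
        by (rule mult_right_mono[OF U_le]) simp
      then show "epowr (U x) p * ennreal (w x) \<le> ennreal (2 powr p) * (\<Sum>k. epowr (c k x) p * ennreal (w x))"
        unfolding ennreal_suminf_multc mult.assoc .
    qed
    also have "\<dots> = ennreal (2 powr p) * (\<Sum>k. ?\<Phi> (c k))"
      by (subst nn_integral_cmult, measurable, subst nn_integral_suminf) simp_all
    also have "\<dots> \<le> ennreal (2 powr p) * (\<Sum>k. ennreal ((1 / 2) ^ k) * ?\<Phi> g)"
      by (intro mult_left_mono suminf_le c_moment) auto
    also have "\<dots> = ennreal (2 powr p) * (2 * ?\<Phi> g)"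
      by (simp only: ennreal_suminf_multc geo)
    also have "\<dots> = ennreal (2 powr p * 2) * ?\<Phi> g"
      by (simp add: ennreal_mult mult.assoc)
    finally have \<Phi>U: "?\<Phi> U \<le> ennreal (2 powr p * 2) * ?\<Phi> g" .
    also have "\<dots> < top"
      using g_fin by (simp add: ennreal_mult_less_top)
    finally have "AE x in M. epowr (U x) p * ennreal (w x) \<noteq> \<infinity>"
      by (intro nn_integral_noteq_infinite) auto
    then have U_fin: "AE x in M. U x < top"
      using AE_space
    proof eventually_elim
      case (elim x)
      then show ?case
        using Ap_pos[OF Ap elim(2)] by (auto simp: ennreal_mult_eq_top_iff less_top[symmetric])
    qed
    \<comment> \<open>The value 1 on the null set where \<open>U\<close> is infinite keeps
      \<open>u\<close> positive everywhere; \<open>enn2real\<close> alone would give 0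
      there.\<close>
    define u where "u x = (if U x = top then 1 else enn2real (U x))" for x
    have [measurable]: "u \<in> borel_measurable M"
      unfolding u_def[abs_def] by measurable
    have uU: "AE x in M. ennreal (u x) = U x"
      using U_fin by eventually_elim (auto simp: u_def)
    have u_pos: "0 < u x" if "x \<in> space M" for x
      using g_pos gU[of x] that by (auto simp: u_def enn2real_positive_iff less_top[symmetric] intro: less_le_trans)
    have "AE x in M. E n (\<lambda>y. ennreal (u y)) x \<le> ennreal (2 * s * u x)" for n
    proof -
      have "AE x in M. E n (\<lambda>y. ennreal (u y)) x = E n U x"
        using uU by (intro F.nn_cond_exp_cong) auto
      moreover have "AE x in M. (\<Sum>k. E n (\<lambda>y. ennreal ((1 / 2) ^ k) * c k y) x) = E n U x"
        unfolding U_def[abs_def] by (intro nn_cond_exp_suminf) measurable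
      moreover have "AE x in M. \<forall>k. ennreal ((1 / 2) ^ k) * E n (c k) x = E n (\<lambda>y. ennreal ((1 / 2) ^ k) * c k y) x"
        unfolding AE_all_countable by (intro allI F.nn_cond_exp_prod) auto
      ultimately show ?thesis
        using uU AE_space
      proof eventually_elim
        case (elim x)
        \<comment> \<open>Term \<open>k\<close> of the averaged series is bounded by term
          \<open>Suc k\<close> of \<open>U\<close>: the shift costs \<open>s\<close> for the
          rescaling and 2 for the geometric weight, whence the \<open>A_1\<close> constant
          \<open>2 * s\<close>.\<close>
        have E_le: "ennreal ((1 / 2) ^ k) * E n (c k) x \<le> ennreal (2 * s) * (ennreal ((1 / 2) ^ Suc k) * c (Suc k) x)" for k
        proof -
          have max: "E n (c k) x \<le> nn_max (c k) x"
            unfolding nn_max_def by (rule SUP_upper) simp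
          have "ennreal (2 * s) * (ennreal ((1 / 2) ^ Suc k) * c (Suc k) x)
            = ennreal (2 * s * ((1 / 2) ^ Suc k * (1 / s))) * nn_max (c k) x"
            using s unfolding c_Suc mult.assoc[symmetric] by (simp only: ennreal_mult[symmetric] zero_le_power zero_le_mult_iff zero_le_divide_iff zero_le_numeral zero_le_one less_imp_le simp_thms)
          also have "2 * s * ((1 / 2) ^ Suc k * (1 / s)) = (1 / 2) ^ k"
            using s by simp
          finally show ?thesis
            using max by (simp add: mult_left_mono)
        qed
        have "E n U x = (\<Sum>k. ennreal ((1 / 2) ^ k) * E n (c k) x)"
          using elim by simp
        also have "\<dots> \<le> (\<Sum>k. ennreal (2 * s) * (ennreal ((1 / 2) ^ Suc k) * c (Suc k) x))"
          by (intro suminf_le E_le) auto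
        also have "\<dots> = ennreal (2 * s) * (\<Sum>k. ennreal ((1 / 2) ^ Suc k) * c (Suc k) x)"
          by (rule ennreal_suminf_cmult)
        also have "(\<Sum>k. ennreal ((1 / 2) ^ Suc k) * c (Suc k) x) \<le> U x"
          unfolding U_def
          by (subst (2) suminf_offset[where i=1]) auto
        finally show ?case
          using elim s u_pos[of x] by (simp add: ennreal_mult mult_left_mono)
      qed
    qed
    moreover have "(\<integral>\<^sup>+x. ennreal (u x powr p) * ennreal (w x) \<partial>M) = ?\<Phi> U"
    proof (intro nn_integral_cong_AE)
      show "AE x in M. ennreal (u x powr p) * ennreal (w x) = epowr (U x) p * ennreal (w x)"
        using uU AE_space
      proof eventually_elim
        case (elim x)
        show ?case
          using u_pos[OF elim(2)] unfolding elim(1)[symmetric] by simp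
      qed
    qed
    moreover have "AE x in M. g x \<le> ennreal (u x)"
      using uU by eventually_elim (simp add: gU)
    ultimately show ?thesis
      using u_pos \<Phi>U by (intro exI[of _ u]) auto
  qed
  moreover have "0 < 2 * s" "(0 :: real) < 2 powr p * 2"
    using s by auto
  ultimately show ?thesis
    by blast
qed

text \<open>With \<open>W = w * u powr (p - r)\<close> one has
  \<open>V powr (p / r) * w = (V * W) powr (p / r) * (u powr p * w) powr (1 - p / r) \<le> V * W + u powr p * w\<close>;
  no Hoelder inequality is needed, since both terms already have the right size.\<close>
lemma extrapolation_down:
  assumes p: "1 < p" "p < r" and K: "0 < K" and Ap: "Ap p K w"
  shows "\<exists>K'>0. \<forall>C>0. \<exists>C'>0. \<forall>V G. V \<in> borel_measurable M \<longrightarrow> G \<in> borel_measurable M \<longrightarrow>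
    (\<forall>x\<in>space M. 0 < V x) \<longrightarrow> (\<forall>x\<in>space M. 0 < G x) \<longrightarrow>
    (\<integral>\<^sup>+x. epowr (G x) (p / r) * ennreal (w x) \<partial>M) < top \<longrightarrow>
    (\<forall>W. Ap r K' W \<longrightarrow> (\<integral>\<^sup>+x. V x * ennreal (W x) \<partial>M) \<le> ennreal C * (\<integral>\<^sup>+x. G x * ennreal (W x) \<partial>M)) \<longrightarrow>
    (\<integral>\<^sup>+x. epowr (V x) (p / r) * ennreal (w x) \<partial>M)
      \<le> ennreal C' * (\<integral>\<^sup>+x. epowr (G x) (p / r) * ennreal (w x) \<partial>M)"
proof -
  from A1_majorant[OF p(1) K] obtain s D where s: "0 < s" and D: "0 < D" and
    majorant: "\<And>w g. Ap p K w \<Longrightarrow> g \<in> borel_measurable M \<Longrightarrow> (\<forall>x\<in>space M. 0 < g x) \<Longrightarrow>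
      (\<integral>\<^sup>+x. epowr (g x) p * ennreal (w x) \<partial>M) < top \<Longrightarrow>
      (\<exists>u. u \<in> borel_measurable M \<and> (\<forall>x\<in>space M. 0 < u x) \<and> (AE x in M. g x \<le> ennreal (u x)) \<and>
        (\<forall>n. AE x in M. E n (\<lambda>y. ennreal (u y)) x \<le> ennreal (s * u x)) \<and>
        (\<integral>\<^sup>+x. ennreal (u x powr p) * ennreal (w x) \<partial>M)
          \<le> ennreal D * (\<integral>\<^sup>+x. epowr (g x) p * ennreal (w x) \<partial>M))"
    by blast
  define K' where "K' = 2 powr (r - 1) * s powr (r - p) * K"
  have K': "0 < K'"
    using s K by (simp add: K'_def)
  have "(\<integral>\<^sup>+x. epowr (V x) (p / r) * ennreal (w x) \<partial>M)
      \<le> ennreal ((C + 1) * D) * (\<integral>\<^sup>+x. epowr (G x) (p / r) * ennreal (w x) \<partial>M)"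
    if C: "0 < C"
      and [measurable]: "V \<in> borel_measurable M" "G \<in> borel_measurable M"
      and G_pos: "\<forall>x\<in>space M. 0 < G x"
      and G_fin: "(\<integral>\<^sup>+x. epowr (G x) (p / r) * ennreal (w x) \<partial>M) < top"
      and hyp: "\<forall>W. Ap r K' W \<longrightarrow>
        (\<integral>\<^sup>+x. V x * ennreal (W x) \<partial>M) \<le> ennreal C * (\<integral>\<^sup>+x. G x * ennreal (W x) \<partial>M)"
    for C V G
  proof -
    note [measurable] = Ap_measurable[OF Ap]
    define g where "g x = epowr (G x) (1 / r)" for x
    have [measurable]: "g \<in> borel_measurable M"
      unfolding g_def[abs_def] by measurable
    have gp: "epowr (g x) p = epowr (G x) (p / r)" for x
      by (simp add: g_def epowr_epowr)
    obtain u where [measurable]: "u \<in> borel_measurable M" and u_pos: "\<And>x. x \<in> space M \<Longrightarrow> 0 < u x"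
      and gu: "AE x in M. g x \<le> ennreal (u x)"
      and A1: "\<And>n. AE x in M. E n (\<lambda>y. ennreal (u y)) x \<le> ennreal (s * u x)"
      and u_le: "(\<integral>\<^sup>+x. ennreal (u x powr p) * ennreal (w x) \<partial>M)
        \<le> ennreal D * (\<integral>\<^sup>+x. epowr (G x) (p / r) * ennreal (w x) \<partial>M)"
      using majorant[OF Ap, of g] G_fin G_pos unfolding gp
      by (auto simp: g_def zero_less_iff_neq_zero)
    define W where "W x = w x * u x powr (p - r)" for x
    have ApW: "Ap r K' W"
      unfolding K'_def W_def[abs_def] using p s K Ap u_pos A1 by (intro Ap_times_A1_powr) auto
    note [measurable] = Ap_measurable[OF ApW]
    have "(\<integral>\<^sup>+x. epowr (V x) (p / r) * ennreal (w x) \<partial>M)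
      \<le> (\<integral>\<^sup>+x. V x * ennreal (W x) + ennreal (u x powr p) * ennreal (w x) \<partial>M)"
    proof (intro nn_integral_mono)
      fix x assume x: "x \<in> space M"
      note pos = Ap_pos[OF Ap x] u_pos[OF x] Ap_pos[OF ApW x]
      have e: "(p - r) * (p / r) + p * (1 - p / r) = 0"
        using p by (simp add: field_simps)
      have "W x powr (p / r) * (u x powr p * w x) powr (1 - p / r)
        = w x powr (p / r + (1 - p / r)) * u x powr ((p - r) * (p / r) + p * (1 - p / r))"
        unfolding W_def powr_add using pos by (simp add: powr_mult powr_powr)
      also have "\<dots> = w x"
        unfolding e using pos by simp
      finally have "epowr (V x) (p / r) * ennreal (w x)
        = epowr (V x * ennreal (W x)) (p / r) * epowr (ennreal (u x powr p * w x)) (1 - p / r)"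
        using p pos by (simp add: epowr_mult mult.assoc flip: ennreal_mult)
      also have "\<dots> \<le> V x * ennreal (W x) + ennreal (u x powr p * w x)"
        using p by (intro epowr_geometric_le_plus) auto
      finally show "epowr (V x) (p / r) * ennreal (w x)
        \<le> V x * ennreal (W x) + ennreal (u x powr p) * ennreal (w x)"
        using pos by (simp add: ennreal_mult)
    qed
    also have "\<dots> = (\<integral>\<^sup>+x. V x * ennreal (W x) \<partial>M) + (\<integral>\<^sup>+x. ennreal (u x powr p) * ennreal (w x) \<partial>M)"
      by (intro nn_integral_add) measurable
    also have "(\<integral>\<^sup>+x. V x * ennreal (W x) \<partial>M) \<le> ennreal C * (\<integral>\<^sup>+x. G x * ennreal (W x) \<partial>M)"
      using hyp ApW by blast
    \<comment> \<open>Because \<open>u\<close> majorizes \<open>g\<close>, the \<open>r\<close>-th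
      root of \<open>G\<close>, one has \<open>G \<le> u powr r\<close> almost everywhere, and
      \<open>u powr r * W = u powr p * w\<close>.\<close>
    also have "(\<integral>\<^sup>+x. G x * ennreal (W x) \<partial>M) \<le> (\<integral>\<^sup>+x. ennreal (u x powr p) * ennreal (w x) \<partial>M)"
    proof (intro nn_integral_mono_AE)
      show "AE x in M. G x * ennreal (W x) \<le> ennreal (u x powr p) * ennreal (w x)"
        using gu AE_space
      proof eventually_elim
        case (elim x)
        note pos = Ap_pos[OF Ap elim(2)] u_pos[OF elim(2)]
        have "G x = epowr (g x) r"
          using p by (simp add: g_def)
        also have "\<dots> \<le> epowr (ennreal (u x)) r"
          using elim p by (intro epowr_mono) auto
        finally have "G x * ennreal (W x) \<le> ennreal (u x powr r) * ennreal (W x)"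
          using pos by (intro mult_right_mono) auto
        also have "\<dots> = ennreal (u x powr p) * ennreal (w x)"
          using pos powr_add[of "u x" r "p - r"] by (simp add: W_def flip: ennreal_mult)
        finally show ?case .
      qed
    qed
    finally have "(\<integral>\<^sup>+x. epowr (V x) (p / r) * ennreal (w x) \<partial>M)
      \<le> ennreal C * (\<integral>\<^sup>+x. ennreal (u x powr p) * ennreal (w x) \<partial>M)
        + (\<integral>\<^sup>+x. ennreal (u x powr p) * ennreal (w x) \<partial>M)"
      by (simp add: add_right_mono mult_left_mono)
    also have "\<dots> = ennreal (C + 1) * (\<integral>\<^sup>+x. ennreal (u x powr p) * ennreal (w x) \<partial>M)"
      using C by (simp add: distrib_right)
    also have "\<dots> \<le> ennreal (C + 1) * (ennreal D * (\<integral>\<^sup>+x. epowr (G x) (p / r) * ennreal (w x) \<partial>M))"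
      by (intro mult_left_mono u_le) auto
    finally show ?thesis
      using C D by (simp add: ennreal_mult mult.assoc)
  qed
  moreover have "0 < (C + 1) * D" if "0 < C" for C
    using that D by simp
  ultimately show ?thesis
    using K' by blast
qed

text \<open>The dual argument: \<open>v\<close> is a truncation of \<open>V\<close>, tested against \<open>v powr (q - 1)\<close>. The latter is
  dominated by \<open>H\<close> with \<open>H * w\<close> in \<open>A\<^sub>r\<close>, obtained from the algorithm for the dual weight \<open>\<sigma>\<close>; a small
  multiple \<open>d\<close> in Young's inequality lets the resulting term be absorbed on the left.\<close>
lemma extrapolation_up:
  assumes r: "1 < r" "r < p" and K: "0 < K" and Ap: "Ap p K w" and w_int: "integrable M w"
  shows "\<exists>K'>0. \<forall>C>0. \<exists>C'>0. \<forall>V G. V \<in> borel_measurable M \<longrightarrow> G \<in> borel_measurable M \<longrightarrow>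
    (\<forall>x\<in>space M. 0 < V x) \<longrightarrow> (\<forall>x\<in>space M. 0 < G x) \<longrightarrow>
    (\<integral>\<^sup>+x. epowr (G x) (p / r) * ennreal (w x) \<partial>M) < top \<longrightarrow>
    (\<forall>W. Ap r K' W \<longrightarrow> (\<integral>\<^sup>+x. V x * ennreal (W x) \<partial>M) \<le> ennreal C * (\<integral>\<^sup>+x. G x * ennreal (W x) \<partial>M)) \<longrightarrow>
    (\<integral>\<^sup>+x. epowr (V x) (p / r) * ennreal (w x) \<partial>M)
      \<le> ennreal C' * (\<integral>\<^sup>+x. epowr (G x) (p / r) * ennreal (w x) \<partial>M)"
proof -
  define p' where "p' = p / (p - 1)"
  define r' where "r' = r / (r - 1)"
  define q where "q = p / r"
  define a where "a = (p - r) / (p - 1)"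
  \<comment> \<open>On the dual side the exponents increase from \<open>p'\<close> to
    \<open>r'\<close>, which is the direction \<open>Ap_times_A1_powr\<close> requires.\<close>
  have p': "1 < p'" "p' < r'"
    using r by (auto simp: p'_def r'_def field_simps)
  have p'_\<sigma>: "p' + -1 / (p - 1) = 1"
    using r by (simp add: p'_def flip: diff_divide_distrib)
  have q: "1 < q" "q / (q - 1) = p / (p - r)" "(p - 1) / r * p' = q"
    "(p - 1) / r * a = q - 1"
    using r by (auto simp: q_def p'_def a_def field_simps)
  have a: "0 < a" "a * (p / (p - r)) = p'"
    using r by (simp_all add: a_def p'_def)
  have r'r: "r' / (r' - 1) = r" "-1 / (r' - 1) = - (r - 1)"
    using r by (auto simp: r'_def field_simps)
  \<comment> \<open>\<open>e1\<close> and \<open>e2\<close> compute the exponents of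
    \<open>w\<close> and \<open>u\<close> in the weight \<open>W\<close> defined below, the
    \<open>r'\<close>-dual of \<open>\<sigma> * u powr (p' - r')\<close>.\<close>
  have e1: "-1 / (p - 1) * - (r - 1) = 1 - a"
    using r by (simp add: a_def field_simps)
  have "p' = 1 + 1 / (p - 1)" "r' = 1 + 1 / (r - 1)"
    using r by (simp_all add: r'_def p'_def field_simps)
  then have diff: "r' - p' = 1 / (r - 1) - 1 / (p - 1)"
    by simp
  have "(p' - r') * - (r - 1) = (r' - p') * (r - 1)"
    by (simp add: algebra_simps)
  also have "\<dots> = (1 / (r - 1) - 1 / (p - 1)) * (r - 1)"
    unfolding diff ..
  also have "\<dots> = 1 - (r - 1) / (p - 1)"
    using r by (simp add: left_diff_distrib)
  also have "\<dots> = a"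
    using r by (simp add: a_def field_simps)
  finally have e2: "(p' - r') * - (r - 1) = a" .
  define K1 where "K1 = K powr (1 / (p - 1))"
  have K1: "0 < K1"
    using K by (simp add: K1_def)
  from A1_majorant[OF p'(1) K1] obtain s D where s: "0 < s" and D: "0 < D" and
    majorant: "\<And>w g. Ap p' K1 w \<Longrightarrow> g \<in> borel_measurable M \<Longrightarrow> (\<forall>x\<in>space M. 0 < g x) \<Longrightarrow>
      (\<integral>\<^sup>+x. epowr (g x) p' * ennreal (w x) \<partial>M) < top \<Longrightarrow>
      (\<exists>u. u \<in> borel_measurable M \<and> (\<forall>x\<in>space M. 0 < u x) \<and> (AE x in M. g x \<le> ennreal (u x)) \<and>
        (\<forall>n. AE x in M. E n (\<lambda>y. ennreal (u y)) x \<le> ennreal (s * u x)) \<and>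
        (\<integral>\<^sup>+x. ennreal (u x powr p') * ennreal (w x) \<partial>M)
          \<le> ennreal D * (\<integral>\<^sup>+x. epowr (g x) p' * ennreal (w x) \<partial>M))"
    by blast
  define K2 where "K2 = 2 powr (r' - 1) * s powr (r' - p') * K1"
  have K2: "0 < K2"
    using s K1 by (simp add: K2_def)
  define K' where "K' = K2 powr (1 / (r' - 1))"
  have K': "0 < K'"
    using K2 by (simp add: K'_def)
  have "(\<integral>\<^sup>+x. epowr (V x) q * ennreal (w x) \<partial>M)
      \<le> ennreal (2 * (C * (1 / (2 * C * D)) powr (1 - q))) * (\<integral>\<^sup>+x. epowr (G x) q * ennreal (w x) \<partial>M)"
    if C: "0 < C"
      and [measurable]: "V \<in> borel_measurable M" "G \<in> borel_measurable M"
      and V_pos: "\<forall>x\<in>space M. 0 < V x"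
      and hyp: "\<forall>W. Ap r K' W \<longrightarrow>
        (\<integral>\<^sup>+x. V x * ennreal (W x) \<partial>M) \<le> ennreal C * (\<integral>\<^sup>+x. G x * ennreal (W x) \<partial>M)"
    for C V G
  proof -
    note [measurable] = Ap_measurable[OF Ap]
    define \<sigma> where "\<sigma> x = w x powr (-1 / (p - 1))" for x
    have Ap\<sigma>: "Ap p' K1 \<sigma>"
      unfolding p'_def K1_def \<sigma>_def[abs_def] using r K Ap by (intro Ap_dual) auto
    note [measurable] = Ap_measurable[OF Ap\<sigma>]
    let ?\<Psi> = "\<lambda>h. \<integral>\<^sup>+x. epowr (h x) q * ennreal (w x) \<partial>M"
    \<comment> \<open>The term to be absorbed will carry the factor \<open>C * d * D\<close>, which
      this choice makes \<open>1 / 2\<close>.\<close>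
    define d where "d = 1 / (2 * C * D)"
    have d: "0 < d" "C * (d * D) = 1 / 2"
      using C D by (auto simp: d_def)
    have bounded: "?\<Psi> (\<lambda>x. min (V x) (of_nat (Suc k))) \<le> 2 * (ennreal (C * d powr (1 - q)) * ?\<Psi> G)" for k
    proof -
      \<comment> \<open>Boundedness of \<open>v\<close> and integrability of \<open>w\<close> make
        \<open>?I\<close> finite, as the absorption requires. Truncating at \<open>Suc k\<close>
        rather than \<open>k\<close> keeps \<open>v\<close> positive for every
        \<open>k\<close>.\<close>
      define v where "v x = enn2real (min (V x) (of_nat (Suc k)))" for x
      have [measurable]: "v \<in> borel_measurable M"
        unfolding v_def[abs_def] by measurable
      have min_fin: "min (V x) (of_nat (Suc k)) < top" for x
        by (simp add: min_less_iff_disj of_nat_less_top del: of_nat_Suc)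
      then have v: "min (V x) (of_nat (Suc k)) = ennreal (v x)" for x
        unfolding v_def by (subst ennreal_enn2real) auto
      have v_pos: "0 < v x" if "x \<in> space M" for x
        using V_pos that min_fin[of x] by (auto simp: v_def enn2real_positive_iff simp del: of_nat_Suc)
      have v_le: "ennreal (v x) \<le> V x" "ennreal (v x) \<le> ennreal (real (Suc k))" for x
        unfolding v[symmetric] by (auto simp: ennreal_of_nat_eq_real_of_nat simp del: of_nat_Suc)
      let ?I = "\<integral>\<^sup>+x. ennreal (v x powr q) * ennreal (w x) \<partial>M"
      have "?I \<le> (\<integral>\<^sup>+x. ennreal (real (Suc k) powr q) * ennreal (w x) \<partial>M)"
        using v_le q v_pos by (intro nn_integral_mono mult_right_mono ennreal_leI powr_mono2)
          (auto simp: less_imp_le simp del: of_nat_Suc)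
      also have "\<dots> = ennreal (real (Suc k) powr q) * (\<integral>\<^sup>+x. ennreal (w x) \<partial>M)"
        by (intro nn_integral_cmult) measurable
      also have "(\<integral>\<^sup>+x. ennreal (w x) \<partial>M) < top \<Longrightarrow> \<dots> < top"
        by (simp add: ennreal_mult_less_top)
      finally have I_fin: "?I < top"
        using w_int Ap_pos[OF Ap] by (simp add: nn_integral_eq_integral AE_I2 less_imp_le)
      \<comment> \<open>The exponent serves two purposes: the \<open>p'\<close>-th moment of
        \<open>g\<close> against \<open>\<sigma>\<close> is exactly \<open>?I\<close>, and any
        \<open>u\<close> above \<open>g\<close> gives
        \<open>v powr (q - 1) \<le> (u / w) powr a\<close>.\<close>
      define g where "g x = w x * v x powr ((p - 1) / r)" for x
      have [measurable]: "g \<in> borel_measurable M"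
        unfolding g_def[abs_def] by measurable
      have g_pos: "0 < g x" if "x \<in> space M" for x
        using Ap_pos[OF Ap that] v_pos[OF that] by (simp add: g_def)
      have g_I: "(\<integral>\<^sup>+x. epowr (ennreal (g x)) p' * ennreal (\<sigma> x) \<partial>M) = ?I"
      proof (intro nn_integral_cong)
        fix x assume x: "x \<in> space M"
        note pos = Ap_pos[OF Ap x] v_pos[OF x] g_pos[OF x]
        have "g x powr p' * \<sigma> x = v x powr q * w x powr (p' + -1 / (p - 1))"
          unfolding g_def \<sigma>_def powr_add q(3)[symmetric] using pos by (simp add: powr_mult powr_powr)
        also have "\<dots> = v x powr q * w x"
          unfolding p'_\<sigma> using pos by simp
        finally show "epowr (ennreal (g x)) p' * ennreal (\<sigma> x) = ennreal (v x powr q) * ennreal (w x)"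
          using pos by (simp add: \<sigma>_def flip: ennreal_mult)
      qed
      obtain u where [measurable]: "u \<in> borel_measurable M" and u_pos: "\<And>x. x \<in> space M \<Longrightarrow> 0 < u x"
        and gu: "AE x in M. ennreal (g x) \<le> ennreal (u x)"
        and A1: "\<And>n. AE x in M. E n (\<lambda>y. ennreal (u y)) x \<le> ennreal (s * u x)"
        and u_le: "(\<integral>\<^sup>+x. ennreal (u x powr p') * ennreal (\<sigma> x) \<partial>M) \<le> ennreal D * ?I"
        using majorant[OF Ap\<sigma>, of "\<lambda>x. ennreal (g x)"] I_fin g_pos unfolding g_I by auto
      define W where "W x = (\<sigma> x * u x powr (p' - r')) powr (-1 / (r' - 1))" for x
      have ApW: "Ap r K' W"
      proof -
        have "Ap r' K2 (\<lambda>x. \<sigma> x * u x powr (p' - r'))"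
          unfolding K2_def using p' s K1 Ap\<sigma> u_pos A1 by (intro Ap_times_A1_powr) auto
        then have "Ap (r' / (r' - 1)) K' W"
          unfolding K'_def W_def[abs_def] using p' K2 by (intro Ap_dual) auto
        then show ?thesis
          by (simp add: r'r)
      qed
      \<comment> \<open>The exponent \<open>a\<close> makes \<open>W = H * w\<close>. Moreover the
        moment of \<open>H\<close> against \<open>w\<close> of order \<open>p / (p - r)\<close>, the
        exponent conjugate to \<open>q\<close>, equals the controlled moment of \<open>u\<close>
        against \<open>\<sigma>\<close>.\<close>
      define H where "H x = (u x / w x) powr a" for x
      have [measurable]: "H \<in> borel_measurable M"
        unfolding H_def[abs_def] by measurable
      have WH: "W x = H x * w x" if x: "x \<in> space M" for x
      proof -
        note pos = Ap_pos[OF Ap x] u_pos[OF x]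
        have "W x = w x powr (-1 / (p - 1) * - (r - 1)) * u x powr ((p' - r') * - (r - 1))"
          unfolding W_def r'r \<sigma>_def powr_powr[symmetric] using pos by (subst powr_mult) auto
        then have "W x = w x powr (1 - a) * u x powr a"
          unfolding e1 e2 .
        then show ?thesis
          using pos by (simp add: H_def powr_diff powr_divide)
      qed
      have H_pos: "0 < H x" if "x \<in> space M" for x
        using Ap_pos[OF Ap that] u_pos[OF that] by (simp add: H_def)
      have H_int: "(\<integral>\<^sup>+x. ennreal (H x powr (p / (p - r))) * ennreal (w x) \<partial>M)
        = (\<integral>\<^sup>+x. ennreal (u x powr p') * ennreal (\<sigma> x) \<partial>M)"
      proof (intro nn_integral_cong)
        fix x assume x: "x \<in> space M"
        note pos = Ap_pos[OF Ap x] u_pos[OF x]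
        have "\<sigma> x * w x powr p' = w x powr (p' + -1 / (p - 1))"
          unfolding \<sigma>_def powr_add by simp
        then have "\<sigma> x * w x powr p' = w x"
          unfolding p'_\<sigma> using pos by simp
        then have "H x powr (p / (p - r)) * w x = u x powr p' * \<sigma> x"
          using pos unfolding H_def powr_powr a(2) by (simp add: powr_divide field_simps)
        then show "ennreal (H x powr (p / (p - r))) * ennreal (w x) = ennreal (u x powr p') * ennreal (\<sigma> x)"
          using pos by (simp add: \<sigma>_def flip: ennreal_mult)
      qed
      have "?I \<le> (\<integral>\<^sup>+x. V x * ennreal (W x) \<partial>M)"
      proof (intro nn_integral_mono_AE)
        show "AE x in M. ennreal (v x powr q) * ennreal (w x) \<le> V x * ennreal (W x)"
          using gu AE_space
        proof eventually_elim
          case (elim x)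
          note pos = Ap_pos[OF Ap elim(2)] u_pos[OF elim(2)] v_pos[OF elim(2)] H_pos[OF elim(2)]
          have "v x powr ((p - 1) / r) \<le> u x / w x"
            using elim pos by (simp add: g_def field_simps)
          then have "(v x powr ((p - 1) / r)) powr a \<le> H x"
            unfolding H_def using a by (intro powr_mono2) auto
          then have vH: "v x powr (q - 1) \<le> H x"
            unfolding powr_powr q(4) .
          have "v x powr q = v x * v x powr (q - 1)"
            using pos powr_add[of "v x" 1 "q - 1"] by simp
          also have "\<dots> \<le> v x * H x"
            using vH pos by (intro mult_left_mono) auto
          finally have "v x powr q * w x \<le> v x * H x * w x"
            using pos by (intro mult_right_mono) auto
          then have "ennreal (v x powr q) * ennreal (w x) \<le> ennreal (v x) * ennreal (W x)"
            using pos by (simp add: WH[OF elim(2)] mult.assoc flip: ennreal_mult)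
          also have "\<dots> \<le> V x * ennreal (W x)"
            by (intro mult_right_mono v_le) auto
          finally show ?case .
        qed
      qed
      also have "\<dots> \<le> ennreal C * (\<integral>\<^sup>+x. G x * ennreal (W x) \<partial>M)"
        using hyp ApW by blast
      also have "(\<integral>\<^sup>+x. G x * ennreal (W x) \<partial>M)
        \<le> (\<integral>\<^sup>+x. ennreal d * (ennreal (H x powr (p / (p - r))) * ennreal (w x))
          + ennreal (d powr (1 - q)) * (epowr (G x) q * ennreal (w x)) \<partial>M)"
      proof (intro nn_integral_mono)
        fix x assume x: "x \<in> space M"
        note pos = Ap_pos[OF Ap x] H_pos[OF x]
        have "G x * ennreal (W x) = G x * ennreal (H x) * ennreal (w x)"
          using pos by (simp add: WH[OF x] ennreal_mult mult.assoc)
        also have "\<dots> \<le> (ennreal d * epowr (ennreal (H x)) (q / (q - 1)) + ennreal (d powr (1 - q)) * epowr (G x) q)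
            * ennreal (w x)"
          using q d by (intro mult_right_mono mult_le_epowr_plus_epowr) auto
        finally show "G x * ennreal (W x) \<le> ennreal d * (ennreal (H x powr (p / (p - r))) * ennreal (w x))
          + ennreal (d powr (1 - q)) * (epowr (G x) q * ennreal (w x))"
          using pos unfolding q(2) by (simp add: distrib_right mult.assoc)
      qed
      also have "\<dots> = ennreal d * (\<integral>\<^sup>+x. ennreal (H x powr (p / (p - r))) * ennreal (w x) \<partial>M)
        + ennreal (d powr (1 - q)) * ?\<Psi> G"
        by (simp add: nn_integral_add nn_integral_cmult)
      also have "(\<integral>\<^sup>+x. ennreal (H x powr (p / (p - r))) * ennreal (w x) \<partial>M) \<le> ennreal D * ?I"
        unfolding H_int by (rule u_le)
      finally have "?I \<le> ennreal C * (ennreal d * (ennreal D * ?I) + ennreal (d powr (1 - q)) * ?\<Psi> G)"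
        by (simp add: add_right_mono mult_left_mono)
      also have "\<dots> = ennreal (C * (d * D)) * ?I + ennreal (C * d powr (1 - q)) * ?\<Psi> G"
        using C D d(1) by (simp add: distrib_left ennreal_mult mult.assoc)
      finally have "?I \<le> 2 * (ennreal (C * d powr (1 - q)) * ?\<Psi> G)"
        unfolding d(2) using I_fin by (intro ennreal_absorb_half)
      then show ?thesis
        unfolding v by (simp add: v_def)
    qed
    have SUP_min: "(SUP k. min (V x) (of_nat (Suc k))) = V x" for x
    proof (rule antisym)
      show "V x \<le> (SUP k. min (V x) (of_nat (Suc k)))"
      proof (cases "V x" rule: ennreal_cases)
        case (real y)
        obtain k where "y \<le> real (Suc k)"
          using real_arch_simple[of y] by (metis of_nat_Suc order_trans le_add_same_cancel2 zero_le_one add.commute)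
        then have "min (V x) (of_nat (Suc k)) = V x"
          using real by (simp add: min_def ennreal_of_nat_eq_real_of_nat del: of_nat_Suc)
        then show ?thesis
          by (metis SUP_upper UNIV_I)
      next
        case top
        have "(SUP k. of_nat k :: ennreal) \<le> (SUP k. of_nat (Suc k))"
          by (intro SUP_mono) (metis UNIV_I le_SucI order_refl of_nat_mono)
        also have "(SUP k. of_nat (Suc k)) = (SUP k. min (V x) (of_nat (Suc k)))"
          using top by simp
        finally show ?thesis
          by (simp only: ennreal_SUP_of_nat_eq_top top)
      qed
    qed (auto intro: SUP_least)
    \<comment> \<open>The bound for the truncations is uniform in \<open>k\<close>, so monotone
      convergence removes the truncation.\<close>
    have "?\<Psi> V = (\<integral>\<^sup>+x. (SUP k. epowr (min (V x) (of_nat (Suc k))) q * ennreal (w x)) \<partial>M)"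
      using q by (subst (1) SUP_min[symmetric]) (simp add: epowr_SUP SUP_mult_right_ennreal del: of_nat_Suc)
    also have "\<dots> = (SUP k. ?\<Psi> (\<lambda>x. min (V x) (of_nat (Suc k))))"
    proof (intro nn_integral_monotone_convergence_SUP)
      show "incseq (\<lambda>k x. epowr (min (V x) (of_nat (Suc k))) q * ennreal (w x))"
        using q by (intro incseq_SucI le_funI mult_right_mono epowr_mono min.mono) auto
    qed measurable
    also have "\<dots> \<le> 2 * (ennreal (C * d powr (1 - q)) * ?\<Psi> G)"
      by (rule SUP_least) (rule bounded)
    finally show ?thesis
      using C by (simp add: d_def ennreal_mult mult.assoc)
  qed
  moreover have "0 < 2 * (C * (1 / (2 * C * D)) powr (1 - q))" if "0 < C" for C
    using that D by simp
  ultimately show ?thesis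
    using K' unfolding q_def by blast
qed

text \<open>Rubio de Francia's extrapolation theorem for pairs \<open>(V, G)\<close>, stated for \<open>r\<close>-th powers.
  Both directions need strict positivity, which is achieved by adding a constant \<open>\<epsilon>\<close> to \<open>V\<close> and \<open>G\<close>.\<close>
lemma extrapolation:
  assumes p: "1 < p" and r: "1 < r" and K: "0 < K" and Ap: "Ap p K w" and w_int: "integrable M w"
  shows "\<exists>K'>0. \<forall>C>0. \<exists>C'>0. \<forall>V G. V \<in> borel_measurable M \<longrightarrow> G \<in> borel_measurable M \<longrightarrow>
    (\<forall>W. Ap r K' W \<longrightarrow> (\<integral>\<^sup>+x. V x * ennreal (W x) \<partial>M) \<le> ennreal C * (\<integral>\<^sup>+x. G x * ennreal (W x) \<partial>M)) \<longrightarrow>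
    (\<integral>\<^sup>+x. epowr (V x) (p / r) * ennreal (w x) \<partial>M)
      \<le> ennreal C' * (\<integral>\<^sup>+x. epowr (G x) (p / r) * ennreal (w x) \<partial>M)"
proof -
  note [measurable] = Ap_measurable[OF Ap]
  define q where "q = p / r"
  have q: "0 < q"
    using p r by (simp add: q_def)
  let ?\<Psi> = "\<lambda>h. \<integral>\<^sup>+x. epowr (h x) q * ennreal (w x) \<partial>M"
  obtain m where m: "0 \<le> m" "(\<integral>\<^sup>+x. ennreal (w x) \<partial>M) = ennreal m"
    using w_int Ap_pos[OF Ap] by (metis nn_integral_eq_integral AE_I2 less_imp_le integral_nonneg_AE)
  have pert: "?\<Psi> (\<lambda>x. G x + ennreal e) \<le> ennreal (2 powr q) * (?\<Psi> G + ennreal (e powr q * m))"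
    if "0 < e" and [measurable]: "G \<in> borel_measurable M" for G e
  proof -
    have "?\<Psi> (\<lambda>x. G x + ennreal e)
      \<le> (\<integral>\<^sup>+x. ennreal (2 powr q) * (epowr (G x) q * ennreal (w x) + ennreal (e powr q) * ennreal (w x)) \<partial>M)"
    proof (intro nn_integral_mono)
      fix x
      have "epowr (G x + ennreal e) q * ennreal (w x)
        \<le> ennreal (2 powr q) * (epowr (G x) q + epowr (ennreal e) q) * ennreal (w x)"
        by (intro mult_right_mono epowr_plus_le q) auto
      then show "epowr (G x + ennreal e) q * ennreal (w x)
        \<le> ennreal (2 powr q) * (epowr (G x) q * ennreal (w x) + ennreal (e powr q) * ennreal (w x))"
        using that by (simp add: distrib_left distrib_right mult.assoc)
    qed
    also have "\<dots> = ennreal (2 powr q) * (?\<Psi> G + ennreal (e powr q) * (\<integral>\<^sup>+x. ennreal (w x) \<partial>M))"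
      by (simp add: nn_integral_cmult nn_integral_add)
    finally show ?thesis
      using m by (simp add: ennreal_mult)
  qed
  have "\<exists>K'>0. \<forall>C>0. \<exists>C'>0. \<forall>V G. V \<in> borel_measurable M \<longrightarrow> G \<in> borel_measurable M \<longrightarrow>
    (\<forall>x\<in>space M. 0 < V x) \<longrightarrow> (\<forall>x\<in>space M. 0 < G x) \<longrightarrow> ?\<Psi> G < top \<longrightarrow>
    (\<forall>W. Ap r K' W \<longrightarrow> (\<integral>\<^sup>+x. V x * ennreal (W x) \<partial>M) \<le> ennreal C * (\<integral>\<^sup>+x. G x * ennreal (W x) \<partial>M)) \<longrightarrow>
    ?\<Psi> V \<le> ennreal C' * ?\<Psi> G"
  proof (cases p r rule: linorder_cases)
    case less
    show ?thesis
      using extrapolation_down[OF p less K Ap] unfolding q_def .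
  next
    case equal
    then have "q = 1"
      using r by (simp add: q_def)
    show ?thesis
    proof (rule exI[of _ K], intro conjI K allI impI)
      fix C :: real assume "0 < C"
      then show "\<exists>C'>0. \<forall>V G. V \<in> borel_measurable M \<longrightarrow> G \<in> borel_measurable M \<longrightarrow>
        (\<forall>x\<in>space M. 0 < V x) \<longrightarrow> (\<forall>x\<in>space M. 0 < G x) \<longrightarrow> ?\<Psi> G < top \<longrightarrow>
        (\<forall>W. Ap r K W \<longrightarrow> (\<integral>\<^sup>+x. V x * ennreal (W x) \<partial>M) \<le> ennreal C * (\<integral>\<^sup>+x. G x * ennreal (W x) \<partial>M)) \<longrightarrow>
        ?\<Psi> V \<le> ennreal C' * ?\<Psi> G"
        using Ap unfolding equal \<open>q = 1\<close> epowr_exponent_1 by (intro exI[of _ C] conjI allI impI) blast+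
    qed
  next
    case greater
    show ?thesis
      using extrapolation_up[OF r greater K Ap w_int] unfolding q_def .
  qed
  then obtain K' where K': "0 < K'" and strict: "\<And>C. 0 < C \<Longrightarrow> \<exists>C'>0. \<forall>V G.
    V \<in> borel_measurable M \<longrightarrow> G \<in> borel_measurable M \<longrightarrow>
    (\<forall>x\<in>space M. 0 < V x) \<longrightarrow> (\<forall>x\<in>space M. 0 < G x) \<longrightarrow> ?\<Psi> G < top \<longrightarrow>
    (\<forall>W. Ap r K' W \<longrightarrow> (\<integral>\<^sup>+x. V x * ennreal (W x) \<partial>M) \<le> ennreal C * (\<integral>\<^sup>+x. G x * ennreal (W x) \<partial>M)) \<longrightarrow>
    ?\<Psi> V \<le> ennreal C' * ?\<Psi> G"
    by blast
  have "\<exists>C'>0. \<forall>V G. V \<in> borel_measurable M \<longrightarrow> G \<in> borel_measurable M \<longrightarrow>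
    (\<forall>W. Ap r K' W \<longrightarrow> (\<integral>\<^sup>+x. V x * ennreal (W x) \<partial>M) \<le> ennreal C * (\<integral>\<^sup>+x. G x * ennreal (W x) \<partial>M)) \<longrightarrow>
    ?\<Psi> V \<le> ennreal C' * ?\<Psi> G" if C: "0 < C" for C
  proof -
    \<comment> \<open>The hypothesis for the perturbed pair needs a constant of at least 1, since
      the same \<open>e\<close> is added on both sides.\<close>
    have C1: "0 < C + 1"
      using C by simp
    from strict[OF C1] obtain B where B: "0 < B" and strictB: "\<And>V G.
      V \<in> borel_measurable M \<Longrightarrow> G \<in> borel_measurable M \<Longrightarrow>
      \<forall>x\<in>space M. 0 < V x \<Longrightarrow> \<forall>x\<in>space M. 0 < G x \<Longrightarrow> ?\<Psi> G < top \<Longrightarrow>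
      \<forall>W. Ap r K' W \<longrightarrow> (\<integral>\<^sup>+x. V x * ennreal (W x) \<partial>M)
        \<le> ennreal (C + 1) * (\<integral>\<^sup>+x. G x * ennreal (W x) \<partial>M) \<Longrightarrow>
      ?\<Psi> V \<le> ennreal B * ?\<Psi> G"
      by blast
    have "?\<Psi> V \<le> ennreal (B * 2 powr q) * ?\<Psi> G"
      if [measurable]: "V \<in> borel_measurable M" "G \<in> borel_measurable M"
        and hyp: "\<forall>W. Ap r K' W \<longrightarrow>
          (\<integral>\<^sup>+x. V x * ennreal (W x) \<partial>M) \<le> ennreal C * (\<integral>\<^sup>+x. G x * ennreal (W x) \<partial>M)" for V G
    proof (cases "?\<Psi> G = top")
      case True
      then show ?thesis
        using B by (simp add: ennreal_mult_top)
    next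
      case False
      then have fin: "?\<Psi> G < top"
        by (simp add: less_top)
      have step: "?\<Psi> V \<le> ennreal (B * 2 powr q) * ?\<Psi> G + ennreal (B * 2 powr q * (e powr q * m))"
        if e: "0 < e" for e
      proof -
        have "?\<Psi> V \<le> ?\<Psi> (\<lambda>x. V x + ennreal e)"
          using q by (intro nn_integral_mono mult_right_mono epowr_mono) auto
        also have "\<dots> \<le> ennreal B * ?\<Psi> (\<lambda>x. G x + ennreal e)"
        proof (rule strictB)
          have "ennreal (2 powr q) * (?\<Psi> G + ennreal (e powr q * m)) < top"
            using fin by (simp add: ennreal_mult_less_top)
          then show "?\<Psi> (\<lambda>x. G x + ennreal e) < top"
            using pert[OF e, of G] by (auto intro: le_less_trans)
          show "\<forall>W. Ap r K' W \<longrightarrow> (\<integral>\<^sup>+x. (V x + ennreal e) * ennreal (W x) \<partial>M)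
            \<le> ennreal (C + 1) * (\<integral>\<^sup>+x. (G x + ennreal e) * ennreal (W x) \<partial>M)"
          proof (intro allI impI)
            fix W assume W: "Ap r K' W"
            note [measurable] = Ap_measurable[OF W]
            have split: "(\<integral>\<^sup>+x. (f x + ennreal e) * ennreal (W x) \<partial>M)
              = (\<integral>\<^sup>+x. f x * ennreal (W x) \<partial>M) + (\<integral>\<^sup>+x. ennreal e * ennreal (W x) \<partial>M)"
              if [measurable]: "f \<in> borel_measurable M" for f
              by (simp add: distrib_right nn_integral_add)
            have "(\<integral>\<^sup>+x. V x * ennreal (W x) \<partial>M) \<le> ennreal C * (\<integral>\<^sup>+x. G x * ennreal (W x) \<partial>M)"
              using hyp W by blast
            also have "\<dots> \<le> ennreal (C + 1) * (\<integral>\<^sup>+x. G x * ennreal (W x) \<partial>M)"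
              by (intro mult_right_mono ennreal_leI) auto
            finally have "(\<integral>\<^sup>+x. V x * ennreal (W x) \<partial>M) \<le> ennreal (C + 1) * (\<integral>\<^sup>+x. G x * ennreal (W x) \<partial>M)" .
            moreover have "1 * (\<integral>\<^sup>+x. ennreal e * ennreal (W x) \<partial>M)
              \<le> ennreal (C + 1) * (\<integral>\<^sup>+x. ennreal e * ennreal (W x) \<partial>M)"
              using C by (intro mult_right_mono) (auto simp: ennreal_leI simp flip: ennreal_1 simp del: ennreal_plus)
            ultimately show "(\<integral>\<^sup>+x. (V x + ennreal e) * ennreal (W x) \<partial>M)
              \<le> ennreal (C + 1) * (\<integral>\<^sup>+x. (G x + ennreal e) * ennreal (W x) \<partial>M)"
              by (simp add: split distrib_left add_mono del: ennreal_plus)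
          qed
        qed (use e in \<open>auto intro: add_nonneg_pos\<close>)
        also have "\<dots> \<le> ennreal B * (ennreal (2 powr q) * (?\<Psi> G + ennreal (e powr q * m)))"
          using e by (intro mult_left_mono pert) auto
        also have "\<dots> = ennreal (B * 2 powr q) * ?\<Psi> G + ennreal (B * 2 powr q * (e powr q * m))"
          using B m by (simp add: ennreal_mult distrib_left mult.assoc)
        finally show ?thesis .
      qed
      show ?thesis
      proof (rule ennreal_le_epsilon)
        fix \<epsilon> :: real assume \<epsilon>: "0 < \<epsilon>"
        \<comment> \<open>This turns the error term into \<open>\<epsilon> * (m / (m + 1))\<close>;
          dividing by \<open>m + 1\<close> instead of \<open>m\<close> avoids a separate argument
          that the total mass is nonzero.\<close>
        define e where "e = (\<epsilon> / (B * 2 powr q * (m + 1))) powr (1 / q)"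
        have "0 < B * 2 powr q * (m + 1)"
          using B m by simp
        then have e: "0 < e" "e powr q = \<epsilon> / (B * 2 powr q * (m + 1))"
          using q \<epsilon> by (auto simp: e_def powr_powr)
        have "B * 2 powr q * (e powr q * m) = \<epsilon> * (m / (m + 1))"
          unfolding e(2) using B m by simp
        also have "\<dots> \<le> \<epsilon>"
          using m \<epsilon> by (intro mult_left_le) auto
        finally have "ennreal (B * 2 powr q * (e powr q * m)) \<le> ennreal \<epsilon>"
          by (rule ennreal_leI)
        then show "?\<Psi> V \<le> ennreal (B * 2 powr q) * ?\<Psi> G + ennreal \<epsilon>"
          using step[OF e(1)] by (meson add_left_mono order_trans)
      qed
    qed
    moreover have "0 < B * 2 powr q"
      using B by simp
    ultimately show ?thesis
      by blast
  qed
  then show ?thesis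
    using K' unfolding q_def by blast
qed

section \<open>From signed functions to nonnegative ones, and the vector-valued inequality\<close>

lemma doob_max_le_nn_max:
  assumes [measurable]: "f \<in> borel_measurable M"
  shows "AE x in M. doob_max M F f x \<le> nn_max (\<lambda>y. ennreal \<bar>f y\<bar>) x"
proof -
  \<comment> \<open>This comparison holds for every measurable \<open>f\<close>, integrable or not,
    so arbitrary measurable sequences are covered.\<close>
  have "AE x in M. \<forall>n. ennreal \<bar>real_cond_exp M (F n) f x\<bar> \<le> E n (\<lambda>y. ennreal \<bar>f y\<bar>) x"
    unfolding AE_all_countable using F.real_cond_exp_abs by auto
  then show ?thesis
    by eventually_elim (auto simp: doob_max_def nn_max_def intro!: SUP_mono)
qed

text \<open>Extrapolation is applied to the two sums of \<open>r\<close>-th powers as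
  \<open>V\<close> and \<open>G\<close>. They may be infinite, which the extrapolation lemma
  permits.\<close>

lemma vector_valued_strong_type:
  assumes p: "1 < p" and r: "1 < r" and K: "0 < K" and Ap: "Ap p K w" and w_int: "integrable M w"
  shows "\<exists>C>0. \<forall>f :: nat \<Rightarrow> 'a \<Rightarrow> ennreal. (\<forall>j. f j \<in> borel_measurable M) \<longrightarrow>
    (\<integral>\<^sup>+x. epowr (\<Sum>j. epowr (nn_max (f j) x) r) (p / r) * ennreal (w x) \<partial>M)
      \<le> ennreal C * (\<integral>\<^sup>+x. epowr (\<Sum>j. epowr (f j x) r) (p / r) * ennreal (w x) \<partial>M)"
proof -
  from extrapolation[OF assms] obtain K' where K': "0 < K'" and
    ex: "\<And>C. 0 < C \<Longrightarrow> \<exists>C'>0. \<forall>V G. V \<in> borel_measurable M \<longrightarrow> G \<in> borel_measurable M \<longrightarrow>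
      (\<forall>W. Ap r K' W \<longrightarrow> (\<integral>\<^sup>+x. V x * ennreal (W x) \<partial>M) \<le> ennreal C * (\<integral>\<^sup>+x. G x * ennreal (W x) \<partial>M)) \<longrightarrow>
      (\<integral>\<^sup>+x. epowr (V x) (p / r) * ennreal (w x) \<partial>M)
        \<le> ennreal C' * (\<integral>\<^sup>+x. epowr (G x) (p / r) * ennreal (w x) \<partial>M)"
    by blast
  from Ap_strong_type[OF r K'] obtain C where C: "0 < C" and
    strong: "\<And>W f. Ap r K' W \<Longrightarrow> f \<in> borel_measurable M \<Longrightarrow>
      (\<integral>\<^sup>+x. epowr (nn_max f x) r * ennreal (W x) \<partial>M)
      \<le> ennreal C * (\<integral>\<^sup>+x. epowr (f x) r * ennreal (W x) \<partial>M)"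
    by blast
  have diag: "(\<integral>\<^sup>+x. (\<Sum>j. epowr (nn_max (f j) x) r) * ennreal (W x) \<partial>M)
      \<le> ennreal C * (\<integral>\<^sup>+x. (\<Sum>j. epowr (f j x) r) * ennreal (W x) \<partial>M)"
    if f: "\<forall>j. f j \<in> borel_measurable M" and W: "Ap r K' W" for f :: "nat \<Rightarrow> 'a \<Rightarrow> ennreal" and W
  proof -
    note [measurable] = f[rule_format] Ap_measurable[OF W]
    have "(\<integral>\<^sup>+x. (\<Sum>j. epowr (nn_max (f j) x) r) * ennreal (W x) \<partial>M)
      = (\<Sum>j. \<integral>\<^sup>+x. epowr (nn_max (f j) x) r * ennreal (W x) \<partial>M)"
      by (subst nn_integral_suminf[symmetric]) simp_all
    also have "\<dots> \<le> (\<Sum>j. ennreal C * (\<integral>\<^sup>+x. epowr (f j x) r * ennreal (W x) \<partial>M))"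
      using W by (intro suminf_le strong) auto
    also have "\<dots> = ennreal C * (\<Sum>j. \<integral>\<^sup>+x. epowr (f j x) r * ennreal (W x) \<partial>M)"
      by (rule ennreal_suminf_cmult)
    also have "(\<Sum>j. \<integral>\<^sup>+x. epowr (f j x) r * ennreal (W x) \<partial>M)
      = (\<integral>\<^sup>+x. (\<Sum>j. epowr (f j x) r) * ennreal (W x) \<partial>M)"
      by (subst nn_integral_suminf[symmetric]) simp_all
    finally show ?thesis .
  qed
  from ex[OF C] obtain C' where C': "0 < C'" and
    concl: "\<And>V G. V \<in> borel_measurable M \<Longrightarrow> G \<in> borel_measurable M \<Longrightarrow>
      (\<forall>W. Ap r K' W \<longrightarrow> (\<integral>\<^sup>+x. V x * ennreal (W x) \<partial>M) \<le> ennreal C * (\<integral>\<^sup>+x. G x * ennreal (W x) \<partial>M)) \<Longrightarrow>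
      (\<integral>\<^sup>+x. epowr (V x) (p / r) * ennreal (w x) \<partial>M)
        \<le> ennreal C' * (\<integral>\<^sup>+x. epowr (G x) (p / r) * ennreal (w x) \<partial>M)"
    by blast
  show ?thesis
  proof (intro exI[of _ C'] conjI C' allI impI)
    fix f :: "nat \<Rightarrow> 'a \<Rightarrow> ennreal"
    assume f: "\<forall>j. f j \<in> borel_measurable M"
    note [measurable] = f[rule_format]
    show "(\<integral>\<^sup>+x. epowr (\<Sum>j. epowr (nn_max (f j) x) r) (p / r) * ennreal (w x) \<partial>M)
      \<le> ennreal C' * (\<integral>\<^sup>+x. epowr (\<Sum>j. epowr (f j x) r) (p / r) * ennreal (w x) \<partial>M)"
      using diag[OF f] by (intro concl) auto
  qed
qed

end

theorem theorem3p11: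
  fixes M :: "'a measure" and F :: "nat \<Rightarrow> 'a measure" and p :: real and w :: "'a \<Rightarrow> real"
  assumes "prob_space M"
    and "is_filtration M F"
    and "1 < p"
    and "A_p_weight M F p w"
  shows "\<forall>r>1. \<exists>C>0. \<forall>f :: nat \<Rightarrow> 'a \<Rightarrow> real. (\<forall>j. f j \<in> borel_measurable M) \<longrightarrow>
           wLp_norm M p w (\<lambda>x. epowr (\<Sum>j. epowr (doob_max M F (f j) x) r) (1 / r))
           \<le> ennreal C * wLp_norm M p w (\<lambda>x. epowr (\<Sum>j. ennreal (\<bar>f j x\<bar> powr r)) (1 / r))"
proof (intro allI impI)
  fix r :: real assume r: "1 < r"
  interpret prob_space M by fact
  interpret filtered_prob_space M F
    by unfold_locales fact
  note p = \<open>1 < p\<close>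
  from assms(4) obtain K where K: "0 < K" and Ap: "Ap p K w" and w_int: "integrable M w"
    by (auto simp: A_p_weight_def is_weight_def Ap_def)
  from vector_valued_strong_type[OF p r K Ap w_int] obtain C where C: "0 < C" and
    main: "\<And>f :: nat \<Rightarrow> 'a \<Rightarrow> ennreal. \<forall>j. f j \<in> borel_measurable M \<Longrightarrow>
    (\<integral>\<^sup>+x. epowr (\<Sum>j. epowr (nn_max (f j) x) r) (p / r) * ennreal (w x) \<partial>M)
      \<le> ennreal C * (\<integral>\<^sup>+x. epowr (\<Sum>j. epowr (f j x) r) (p / r) * ennreal (w x) \<partial>M)"
    by blast
  show "\<exists>C>0. \<forall>f :: nat \<Rightarrow> 'a \<Rightarrow> real. (\<forall>j. f j \<in> borel_measurable M) \<longrightarrow>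
           wLp_norm M p w (\<lambda>x. epowr (\<Sum>j. epowr (doob_max M F (f j) x) r) (1 / r))
           \<le> ennreal C * wLp_norm M p w (\<lambda>x. epowr (\<Sum>j. ennreal (\<bar>f j x\<bar> powr r)) (1 / r))"
  \<comment> \<open>\<open>C\<close> bounds the \<open>p\<close>-th powers of the norms, so its
    \<open>p\<close>-th root bounds the norms.\<close>
  proof (intro exI[of _ "C powr (1 / p)"] conjI allI impI)
    show "0 < C powr (1 / p)"
      using C by simp
    fix f :: "nat \<Rightarrow> 'a \<Rightarrow> real"
    assume f: "\<forall>j. f j \<in> borel_measurable M"
    note [measurable] = f[rule_format]
    let ?f = "\<lambda>j x. ennreal \<bar>f j x\<bar>"
    have "AE x in M. \<forall>j. doob_max M F (f j) x \<le> nn_max (?f j) x"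
      unfolding AE_all_countable using doob_max_le_nn_max by auto
    then have "(\<integral>\<^sup>+x. epowr (\<Sum>j. epowr (doob_max M F (f j) x) r) (p / r) * ennreal (w x) \<partial>M)
      \<le> (\<integral>\<^sup>+x. epowr (\<Sum>j. epowr (nn_max (?f j) x) r) (p / r) * ennreal (w x) \<partial>M)"
      using p r by (intro nn_integral_mono_AE)
        (auto elim!: eventually_mono intro!: mult_right_mono epowr_mono suminf_le)
    also have "\<dots> \<le> ennreal C * (\<integral>\<^sup>+x. epowr (\<Sum>j. epowr (?f j x) r) (p / r) * ennreal (w x) \<partial>M)"
      by (rule main) auto
    finally have "epowr (\<integral>\<^sup>+x. epowr (\<Sum>j. epowr (doob_max M F (f j) x) r) (p / r) * ennreal (w x) \<partial>M) (1 / p)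
      \<le> epowr (ennreal C * (\<integral>\<^sup>+x. epowr (\<Sum>j. ennreal (\<bar>f j x\<bar> powr r)) (p / r) * ennreal (w x) \<partial>M)) (1 / p)"
      using p by (intro epowr_mono) auto
    then show "wLp_norm M p w (\<lambda>x. epowr (\<Sum>j. epowr (doob_max M F (f j) x) r) (1 / r))
      \<le> ennreal (C powr (1 / p)) * wLp_norm M p w (\<lambda>x. epowr (\<Sum>j. ennreal (\<bar>f j x\<bar> powr r)) (1 / r))"
      using p C by (simp add: wLp_norm_def epowr_epowr epowr_mult)
  qed
qed

end
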